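(* Let $m\le n$, let $Q\in\mathbb{R}^{n\times n}$ be symmetric positive semidefinite, let $A\in\mathbb{R}^{m\times n}$ have full rank, let $\Theta^{(1)}\in\mathbb{R}^{n\times n}$ be diagonal positive definite, and let $\Theta^{(2)}\in\mathbb{R}^{m\times m}$ be diagonal positive semidefinite. Let $G=\mathrm{diag}(Q+\Theta^{(1)})$, let $S=AG^{-1}A^T+\Theta^{(2)}$, and let $S_{inex}\in\mathbb{R}^{m\times m}$ be symmetric positive definite. Set $$\mathcal{A}=\begin{bmatrix} Q+\Theta^{(1)} & A^T\\ A & -\Theta^{(2)}\end{bmatrix},\qquad \mathcal{P}_{inex}=\begin{bmatrix} I_n & 0\\ AG^{-1} & I_m\end{bmatrix}\begin{bmatrix} G & 0\\ 0 & -S_{inex}\end{bmatrix}\begin{bmatrix} I_n & G^{-1}A^T\\ 0 & I_m\end{bmatrix}.$$ Let $X=G^{-\frac12}(Q+\Theta^{(1)})G^{-\frac12}$ and suppose that $2I_n-X$ is positive definite. Define $$\bar\lambda=\lambda_{\max}(S_{inex}^{-1}S)\,\max\{2-\lambda_{\min}(X),\,1\},\qquad \underline{\lambda}=\lambda_{\min}(S_{inex}^{-1}S)\,\min\{2-\lambda_{\max}(X),\,1\}$$ if $\Theta^{(2)}\neq 0$, and $$\bar\lambda=\lambda_{\max}(S_{inex}^{-1}S)\,(2-\lambda_{\min}(X)),\qquad \underline{\lambda}=\lambda_{\min}(S_{inex}^{-1}S)\,(2-\lambda_{\max}(X))$$ if $\Theta^{(2)}=0$. Then $\mathcal{P}_{inex}^{-1}\mathcal{A}$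 has at most $2m$ eigenvalues with nonzero imaginary part, counting conjugates. Furthermore, let $\lambda$ be an eigenvalue of the problem $\mathcal{A}\begin{bmatrix} x \\ y \end{bmatrix}=\lambda\,\mathcal{P}_{inex}\begin{bmatrix} x \\ y \end{bmatrix}$ with corresponding eigenvector $[x^T,y^T]^T$ (with $x$ of length $n$ and $y$ of length $m$). If $\lambda$ has nonzero imaginary part, then $$\tfrac12\left(\lambda_{\min}(X)+\underline{\lambda}\right)\le\mathcal{R}(\lambda)\le\tfrac12\left(\lambda_{\max}(X)+\bar\lambda\right);$$ otherwise $$\min\{\lambda_{\min}(X),\,\underline{\lambda}\}\le\lambda\le\max\{\lambda_{\max}(X),\,\bar\lambda\}\quad\text{for } y\neq 0,$$ $$\lambda_{\min}(X)\le\lambda\le\lambda_{\max}(X)\quad\text{for } y=0.$$ Finally, the imaginary part of $\lambda$ satisfies $$|\mathcal{I}(\lambda)|\le\sqrt{\lambda_{\max}(S_{inex}^{-1}AG^{-1}A^T)}\;\|I_n-X\|.$$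
   Context: $\mathrm{diag}(M)$ denotes the diagonal matrix with the same diagonal entries as $M$. $I_r$ is the $r\times r$ identity matrix. $\|\cdot\|$ is the vector or matrix 2-norm. $\lambda_{\min}(\cdot)$ and $\lambda_{\max}(\cdot)$ denote the minimum and maximum eigenvalues of a matrix with real eigenvalues (symmetric matrices, and products such as $S_{inex}^{-1}S$, which are similar to symmetric matrices). $\mathcal{R}(\alpha)$ and $\mathcal{I}(\alpha)$ denote the real and imaginary parts of a complex number $\alpha$. Eigenvalues and eigenvectors of $\mathcal{P}_{inex}^{-1}\mathcal{A}$ may be complex. *)

theory Defs
  imports
    "Jordan_Normal_Form.Spectral_Radius"
    "Jordan_Normal_Form.DL_Rank"
    "Jordan_Normal_Form.Gauss_Jordan_Elimination"
begin

definition sym_mat :: "real mat \<Rightarrow> bool" where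
  "sym_mat M \<longleftrightarrow> square_mat M \<and> transpose_mat M = M"

definition spsd_mat :: "real mat \<Rightarrow> bool" where
  "spsd_mat M \<longleftrightarrow> sym_mat M \<and> (\<forall>v \<in> carrier_vec (dim_row M). 0 \<le> v \<bullet> (M *\<^sub>v v))"

definition spd_mat :: "real mat \<Rightarrow> bool" where
  "spd_mat M \<longleftrightarrow> sym_mat M \<and>
     (\<forall>v \<in> carrier_vec (dim_row M). v \<noteq> 0\<^sub>v (dim_row M) \<longrightarrow> 0 < v \<bullet> (M *\<^sub>v v))"

definition diag_part :: "real mat \<Rightarrow> real mat" where
  "diag_part M = mat_diag (dim_row M) (\<lambda>i. M $$ (i, i))"

text \<open>The inverse of an invertible matrix; unspecified for singular matrices.\<close>

definition mat_inv :: "'a::field mat \<Rightarrow> 'a mat" where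
  "mat_inv M = the (mat_inverse M)"

text \<open>The power \<open>D\<^sup>-\<^sup>1\<^sup>/\<^sup>2\<close>, meant for diagonal \<open>D\<close> with positive diagonal entries only.\<close>

definition diag_inv_sqrt :: "real mat \<Rightarrow> real mat" where
  "diag_inv_sqrt D = mat_diag (dim_row D) (\<lambda>i. (D $$ (i, i)) powr (- 1 / 2))"

text \<open>
  Extreme eigenvalues of a real matrix of positive size all of whose complex eigenvalues
  are real: \<open>spectrum\<close> is taken over the reals and then contains every eigenvalue.
\<close>

definition lambda_max :: "real mat \<Rightarrow> real" where
  "lambda_max M = Max (spectrum M)"

definition lambda_min :: "real mat \<Rightarrow> real" where
  "lambda_min M = Min (spectrum M)"

definition vec_norm2 :: "real vec \<Rightarrow> real" where
  "vec_norm2 v = sqrt (v \<bullet> v)"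

definition mat_norm2 :: "real mat \<Rightarrow> real" where
  "mat_norm2 M = (SUP v \<in> {v \<in> carrier_vec (dim_col M). vec_norm2 v = 1}. vec_norm2 (M *\<^sub>v v))"

abbreviation cmat :: "real mat \<Rightarrow> complex mat" where
  "cmat \<equiv> map_mat complex_of_real"

text \<open>The number of non-real complex eigenvalues, with algebraic multiplicity.\<close>

definition num_nonreal_eigenvalues :: "real mat \<Rightarrow> nat" where
  "num_nonreal_eigenvalues M =
     (\<Sum>z \<in> {z. eigenvalue (cmat M) z \<and> Im z \<noteq> 0}. Polynomial.order z (char_poly (cmat M)))"

definition gen_eigenpair :: "complex mat \<Rightarrow> complex mat \<Rightarrow> complex \<Rightarrow> complex vec \<Rightarrow> bool" where
  "gen_eigenpair M N z v \<longleftrightarrow>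
     v \<in> carrier_vec (dim_col M) \<and> v \<noteq> 0\<^sub>v (dim_col M) \<and> M *\<^sub>v v = z \<cdot>\<^sub>v (N *\<^sub>v v)"

end

theory Submission
  imports Defs
begin

text \<open>
  Both matrices of the pencil are symmetric, and in the variables \<open>w = x + G\<^sup>-\<^sup>1 A\<^sup>T y\<close> and \<open>y\<close> the
  equation \<open>\<A> v = \<lambda> P v\<close> has the symmetric diagonal blocks \<open>Q + \<Theta>1\<close> and
  \<open>A G\<^sup>-\<^sup>1 (2 G - Q - \<Theta>1) G\<^sup>-\<^sup>1 A\<^sup>T + \<Theta>2\<close>, weighted by \<open>G\<close> and \<open>S_inex\<close>, and off-diagonal
  blocks that are negative transposes of each other. With \<open>p = w\<^sup>* G w\<close> and \<open>q = y\<^sup>* S_inex y\<close>,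
  testing with \<open>w\<close> and \<open>y\<close> gives \<open>a + b = \<lambda> p + \<lambda>\<^sup>* q\<close>, where \<open>a\<close> and \<open>b\<close> are the values of the two
  diagonal forms. Hence \<open>p = q\<close> if \<open>\<lambda>\<close> is not real, \<open>Re \<lambda>\<close> is the weighted mean of \<open>a / p\<close> and
  \<open>b / q\<close>, and \<open>Im \<lambda>\<close> is controlled by the off-diagonal block.
  For the count, \<open>M = P\<^sup>-\<^sup>1 \<A>\<close> is selfadjoint for the indefinite form \<open>P\<close>, so the sum of the
  generalised eigenspaces over the open upper (or lower) half-plane is a neutral subspace for \<open>P\<close>.
  As \<open>P\<close> is definite on a subspace of codimension \<open>m\<close>, its dimension is at most \<open>m\<close>.
\<close>

subsection \<open>Rayleigh quotients\<close>

lemma mat_inv_carrier_inverts: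
  fixes M :: "'a::field mat"
  assumes M: "M \<in> carrier_mat n n" and d: "det M \<noteq> 0"
  shows "mat_inv M \<in> carrier_mat n n" "M * mat_inv M = 1\<^sub>m n" "mat_inv M * M = 1\<^sub>m n"
proof -
  have "mat_inverse M \<noteq> None"
    using det_non_zero_imp_unit[OF M d, of "()"] mat_inverse(1)[OF M, of "()"] by blast
  then obtain B where B: "mat_inverse M = Some B" by blast
  from mat_inverse(2)[OF M B] B
  show "mat_inv M \<in> carrier_mat n n" "M * mat_inv M = 1\<^sub>m n" "mat_inv M * M = 1\<^sub>m n"
    by (auto simp: mat_inv_def)
qed

lemma scalar_prod_transpose:
  fixes M :: "real mat"
  assumes "M \<in> carrier_mat r c" "x \<in> carrier_vec r" "y \<in> carrier_vec c"
  shows "x \<bullet> (M *\<^sub>v y) = (M\<^sup>T *\<^sub>v x) \<bullet> y"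
  using transpose_vec_mult_scalar[of M r c y x] assms by simp

lemma sym_mat_scalar_prod:
  assumes "sym_mat M" "M \<in> carrier_mat n n" "x \<in> carrier_vec n" "y \<in> carrier_vec n"
  shows "x \<bullet> (M *\<^sub>v y) = y \<bullet> (M *\<^sub>v x)"
proof -
  have "x \<bullet> (M *\<^sub>v y) = (M *\<^sub>v x) \<bullet> y"
    using scalar_prod_transpose[of M n n x y] assms by (simp add: sym_mat_def)
  also have "\<dots> = y \<bullet> (M *\<^sub>v x)"
    using assms by (intro comm_scalar_prod) auto
  finally show ?thesis .
qed

lemma scalar_prod_self_nonneg: "0 \<le> (x :: real vec) \<bullet> x"
  by (simp add: scalar_prod_def sum_nonneg)

lemma scalar_prod_self_pos:
  assumes "x \<in> carrier_vec n" "(x :: real vec) \<noteq> 0\<^sub>v n"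
  shows "0 < x \<bullet> x"
proof -
  from assms obtain i where i: "i < n" "x $ i \<noteq> 0" by (metis eq_vecI carrier_vecD index_zero_vec)
  have "0 < (x $ i) * (x $ i)" using i by (auto simp: zero_less_mult_iff linorder_neq_iff)
  then show ?thesis unfolding scalar_prod_def using i assms
    by (intro sum_pos2[of _ i]) auto
qed

text \<open>For \<open>c > 0\<close> the quadratic is evaluated at its minimiser
  \<open>- b / c\<close>. For \<open>c = 0\<close> it is affine in \<open>t\<close>, and a nonzero
  slope would make it negative somewhere. The case \<open>c = 0\<close> lets Cauchy-Schwarz hold for
  merely semidefinite forms.\<close>

lemma discriminant_nonpos:
  fixes a b c :: real
  assumes "\<And>t. 0 \<le> a + 2 * t * b + t^2 * c" and "0 \<le> c"
  shows "b^2 \<le> a * c"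
proof (cases "c = 0")
  case True
  have "b = 0"
  proof (rule ccontr)
    assume "b \<noteq> 0"
    \<comment> \<open>At this \<open>t\<close> the affine function takes the value
      \<open>- 1\<close>.\<close>
    then show False using assms(1)[of "- (a + 1) / (2 * b)"] True by (simp add: field_simps)
  qed
  then show ?thesis using True by simp
next
  case False
  then have c: "0 < c" using assms by simp
  have "0 \<le> a - b^2 / c"
    using assms(1)[of "- b / c"] c by (simp add: power2_eq_square field_simps)
  then show ?thesis using c by (simp add: field_simps)
qed

lemma spsd_mat_cauchy_schwarz:
  assumes M: "spsd_mat M" "M \<in> carrier_mat n n" and x: "x \<in> carrier_vec n" and y: "y \<in> carrier_vec n"
  shows "(x \<bullet> (M *\<^sub>v y))^2 \<le> (x \<bullet> (M *\<^sub>v x)) * (y \<bullet> (M *\<^sub>v y))"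
proof (rule discriminant_nonpos)
  fix t
  have s: "y \<bullet> (M *\<^sub>v x) = x \<bullet> (M *\<^sub>v y)"
    using M x y by (intro sym_mat_scalar_prod[of _ n]) (auto simp: spsd_mat_def)
  have "0 \<le> (x + t \<cdot>\<^sub>v y) \<bullet> (M *\<^sub>v (x + t \<cdot>\<^sub>v y))"
    using M x y by (auto simp: spsd_mat_def)
  also have "M *\<^sub>v (x + t \<cdot>\<^sub>v y) = M *\<^sub>v x + t \<cdot>\<^sub>v (M *\<^sub>v y)"
    using M x y by (simp add: mult_add_distrib_mat_vec[of _ n n] mult_mat_vec[of _ n n])
  also have "(x + t \<cdot>\<^sub>v y) \<bullet> (M *\<^sub>v x + t \<cdot>\<^sub>v (M *\<^sub>v y))
      = x \<bullet> (M *\<^sub>v x) + 2 * t * (x \<bullet> (M *\<^sub>v y)) + t^2 * (y \<bullet> (M *\<^sub>v y))"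
    using M x y
    by (simp add: add_scalar_prod_distrib[of _ n] scalar_prod_add_distrib[of _ n] s
        power2_eq_square algebra_simps)
  finally show "0 \<le> x \<bullet> (M *\<^sub>v x) + 2 * t * (x \<bullet> (M *\<^sub>v y)) + t^2 * (y \<bullet> (M *\<^sub>v y))" .
qed (use M y in \<open>auto simp: spsd_mat_def\<close>)

lemma scalar_prod_cauchy_schwarz:
  fixes x y :: "real vec"
  assumes "x \<in> carrier_vec n" "y \<in> carrier_vec n"
  shows "(x \<bullet> y)^2 \<le> (x \<bullet> x) * (y \<bullet> y)"
proof -
  have "spsd_mat (1\<^sub>m n)" by (auto simp: spsd_mat_def sym_mat_def scalar_prod_self_nonneg)
  from spsd_mat_cauchy_schwarz[OF this _ assms] assms show ?thesis by simp
qed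

text \<open>Cauchy-Schwarz row by row, with the sum of the squared entries of \<open>M\<close> as
  constant; the added 1 keeps the constant positive when \<open>M\<close> is zero.\<close>

lemma mult_mat_vec_bounded:
  fixes M :: "real mat"
  assumes M: "M \<in> carrier_mat r c"
  obtains C where "0 < C"
    and "\<And>x. x \<in> carrier_vec c \<Longrightarrow> (M *\<^sub>v x) \<bullet> (M *\<^sub>v x) \<le> C * (x \<bullet> x)"
proof
  let ?C = "\<Sum>i<r. row M i \<bullet> row M i"
  show "0 < 1 + ?C" by (simp add: add_pos_nonneg sum_nonneg scalar_prod_self_nonneg)
  fix x :: "real vec" assume x: "x \<in> carrier_vec c"
  have "(M *\<^sub>v x) \<bullet> (M *\<^sub>v x) = (\<Sum>i<r. (row M i \<bullet> x)^2)"
    using M by (simp add: scalar_prod_def[of "M *\<^sub>v x"] power2_eq_square atLeast0LessThan)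
  also have "\<dots> \<le> (\<Sum>i<r. (row M i \<bullet> row M i) * (x \<bullet> x))"
    using M x by (intro sum_mono scalar_prod_cauchy_schwarz[of _ c]) auto
  also have "\<dots> \<le> (1 + ?C) * (x \<bullet> x)"
    by (simp add: sum_distrib_right distrib_right scalar_prod_self_nonneg)
  finally show "(M *\<^sub>v x) \<bullet> (M *\<^sub>v x) \<le> (1 + ?C) * (x \<bullet> x)" .
qed

text \<open>Expanding the square of \<open>x - M x\<close> bounds twice the form by
  \<open>x \<bullet> x + (M x) \<bullet> (M x)\<close>.\<close>

lemma quadratic_form_bounded:
  fixes M :: "real mat"
  assumes M: "M \<in> carrier_mat n n"
  obtains C where "0 < C" and "\<And>x. x \<in> carrier_vec n \<Longrightarrow> x \<bullet> (M *\<^sub>v x) \<le> C * (x \<bullet> x)"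
proof -
  from mult_mat_vec_bounded[OF M] obtain C where C: "0 < C"
    and le: "\<And>x. x \<in> carrier_vec n \<Longrightarrow> (M *\<^sub>v x) \<bullet> (M *\<^sub>v x) \<le> C * (x \<bullet> x)" by blast
  show ?thesis
  proof
    show "0 < (1 + C) / 2" using C by simp
    fix x :: "real vec" assume x: "x \<in> carrier_vec n"
    have "0 \<le> (x - M *\<^sub>v x) \<bullet> (x - M *\<^sub>v x)" by (rule scalar_prod_self_nonneg)
    also have "\<dots> = x \<bullet> x - 2 * (x \<bullet> (M *\<^sub>v x)) + (M *\<^sub>v x) \<bullet> (M *\<^sub>v x)"
      using M x comm_scalar_prod[of "M *\<^sub>v x" n x]
      by (simp add: minus_scalar_prod_distrib[of _ n] scalar_prod_minus_distrib[of _ n])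
    finally show "x \<bullet> (M *\<^sub>v x) \<le> (1 + C) / 2 * (x \<bullet> x)"
      using le[OF x] by (simp add: algebra_simps)
  qed
qed

text \<open>With \<open>y = K x\<close>, boundedness of the inverse gives
  \<open>x \<bullet> x \<le> C * (y \<bullet> y)\<close>, and Cauchy-Schwarz for the form of
  \<open>K\<close> gives \<open>y \<bullet> y \<le> D * (x \<bullet> (K x))\<close>, where
  \<open>D\<close> bounds that form from above. Nonsingularity thus turns semidefiniteness into a
  quantitative lower bound.\<close>

lemma spsd_mat_coercive:
  assumes K: "spsd_mat K" "K \<in> carrier_mat n n" and d: "det K \<noteq> 0"
  obtains C where "0 < C" and "\<And>x. x \<in> carrier_vec n \<Longrightarrow> x \<bullet> x \<le> C * (x \<bullet> (K *\<^sub>v x))"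
proof -
  note inv = mat_inv_carrier_inverts[OF K(2) d]
  from mult_mat_vec_bounded[OF inv(1)] obtain C where C: "0 < C"
    and leC: "\<And>x. x \<in> carrier_vec n \<Longrightarrow> (mat_inv K *\<^sub>v x) \<bullet> (mat_inv K *\<^sub>v x) \<le> C * (x \<bullet> x)" by blast
  from quadratic_form_bounded[OF K(2)] obtain D where D: "0 < D"
    and leD: "\<And>x. x \<in> carrier_vec n \<Longrightarrow> x \<bullet> (K *\<^sub>v x) \<le> D * (x \<bullet> x)" by blast
  show ?thesis
  proof
    show "0 < C * D" using C D by simp
    fix x :: "real vec" assume x: "x \<in> carrier_vec n"
    define y where "y = K *\<^sub>v x"
    have y: "y \<in> carrier_vec n" using K x by (simp add: y_def)
    have q: "0 \<le> x \<bullet> (K *\<^sub>v x)" using K x by (auto simp: spsd_mat_def)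
    have "mat_inv K *\<^sub>v y = x"
      unfolding y_def using inv K x by (simp flip: assoc_mult_mat_vec)
    then have xy: "x \<bullet> x \<le> C * (y \<bullet> y)" using leC[OF y] by simp
    have "(y \<bullet> y)^2 = (x \<bullet> (K *\<^sub>v y))^2"
      using K x y sym_mat_scalar_prod[of K n x y] by (simp add: spsd_mat_def y_def)
    also have "\<dots> \<le> (x \<bullet> (K *\<^sub>v x)) * (y \<bullet> (K *\<^sub>v y))"
      by (rule spsd_mat_cauchy_schwarz[OF K x y])
    also have "\<dots> \<le> (x \<bullet> (K *\<^sub>v x)) * (D * (y \<bullet> y))"
      using q leD[OF y] by (intro mult_left_mono)
    finally have *: "(y \<bullet> y) * (y \<bullet> y) \<le> (D * (x \<bullet> (K *\<^sub>v x))) * (y \<bullet> y)"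
      by (simp add: power2_eq_square mult_ac)
    have "y \<bullet> y \<le> D * (x \<bullet> (K *\<^sub>v x))"
    proof (cases "y \<bullet> y = 0")
      case False
      then have "0 < y \<bullet> y" using scalar_prod_self_nonneg[of y] by simp
      with * show ?thesis by simp
    qed (use D q in simp)
    with xy C have "x \<bullet> x \<le> C * (D * (x \<bullet> (K *\<^sub>v x)))"
      by (meson mult_left_mono order_trans less_imp_le)
    then show "x \<bullet> x \<le> C * D * (x \<bullet> (K *\<^sub>v x))" by (simp add: mult_ac)
  qed
qed

lemma smult_mult_mat_vec:
  fixes M :: "real mat"
  assumes "M \<in> carrier_mat r c" "x \<in> carrier_vec c"
  shows "(t \<cdot>\<^sub>m M) *\<^sub>v x = t \<cdot>\<^sub>v (M *\<^sub>v x)"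
  using assms by (intro eq_vecI) auto

lemma spd_mat_imp_spsd_mat: "spd_mat M \<Longrightarrow> spsd_mat M"
  unfolding spd_mat_def spsd_mat_def sym_mat_def
  by (metis carrier_matI less_eq_real_def mult_mat_vec_carrier scalar_prod_left_zero square_mat.simps)

lemma spd_mat_det_nonzero:
  assumes "spd_mat M" "M \<in> carrier_mat n n"
  shows "det M \<noteq> 0"
proof
  assume "det M = 0"
  then obtain v where "v \<in> carrier_vec n" "v \<noteq> 0\<^sub>v n" "M *\<^sub>v v = 0\<^sub>v n"
    using det_0_iff_vec_prod_zero_field[OF assms(2)] by blast
  moreover from this have "0 < v \<bullet> (M *\<^sub>v v)" using assms by (auto simp: spd_mat_def)
  ultimately show False by simp
qed

text \<open>The supremum of the Rayleigh quotient is attained without any compactness argument: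
  at the supremum \<open>t\<close> the form of \<open>t N - M\<close> is positive semidefinite; were that matrix
  nonsingular, it would dominate a positive multiple of \<open>N\<close>, and \<open>t\<close> could be lowered.\<close>

lemma max_rayleigh_quotient_attained:
  assumes n: "0 < n" and N: "spd_mat N" "N \<in> carrier_mat n n"
    and M: "sym_mat M" "M \<in> carrier_mat n n"
  obtains \<mu> v where "v \<in> carrier_vec n" "v \<noteq> 0\<^sub>v n" "M *\<^sub>v v = \<mu> \<cdot>\<^sub>v (N *\<^sub>v v)"
    and "\<And>x. x \<in> carrier_vec n \<Longrightarrow> x \<bullet> (M *\<^sub>v x) \<le> \<mu> * (x \<bullet> (N *\<^sub>v x))"
proof -
  \<comment> \<open>The upper bounds of the Rayleigh quotient, stated without division so that the
    zero vector satisfies the condition trivially. Their infimum \<open>t\<close> is the supremum of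
    the quotient.\<close>
  define U where "U = {t. \<forall>x\<in>carrier_vec n. x \<bullet> (M *\<^sub>v x) \<le> t * (x \<bullet> (N *\<^sub>v x))}"
  have posN: "0 < x \<bullet> (N *\<^sub>v x)" if "x \<in> carrier_vec n" "x \<noteq> 0\<^sub>v n" for x
    using N that by (auto simp: spd_mat_def)
  have ratio_le: "x \<bullet> (M *\<^sub>v x) / (x \<bullet> (N *\<^sub>v x)) \<le> t"
    if "x \<in> carrier_vec n" "x \<noteq> 0\<^sub>v n" "t \<in> U" for x t
    using posN[of x] that by (simp add: U_def divide_le_eq)
  \<comment> \<open>\<open>n > 0\<close> supplies a nonzero vector, whose quotient is a lower bound
    of \<open>U\<close>.\<close>
  have unit: "unit_vec n 0 \<noteq> (0\<^sub>v n :: real vec)" using n by (simp add: unit_vec_nonzero)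
  have bdd: "bdd_below U"
    by (rule bdd_belowI, rule ratio_le[of "unit_vec n 0"]) (use n unit in auto)
  have ne: "U \<noteq> {}"
  proof -
    from spsd_mat_coercive[OF spd_mat_imp_spsd_mat[OF N(1)] N(2) spd_mat_det_nonzero[OF N]]
    obtain C where C: "0 < C" "\<And>x. x \<in> carrier_vec n \<Longrightarrow> x \<bullet> x \<le> C * (x \<bullet> (N *\<^sub>v x))" by blast
    from quadratic_form_bounded[OF M(2)] obtain D where
      D: "0 < D" "\<And>x. x \<in> carrier_vec n \<Longrightarrow> x \<bullet> (M *\<^sub>v x) \<le> D * (x \<bullet> x)" by blast
    have "D * C \<in> U"
      unfolding U_def
    proof (safe)
      fix x :: "real vec" assume x: "x \<in> carrier_vec n"
      have "x \<bullet> (M *\<^sub>v x) \<le> D * (x \<bullet> x)" by (rule D(2)[OF x])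
      also have "\<dots> \<le> D * (C * (x \<bullet> (N *\<^sub>v x)))" using C(2)[OF x] D(1) by simp
      finally show "x \<bullet> (M *\<^sub>v x) \<le> D * C * (x \<bullet> (N *\<^sub>v x))" by (simp add: mult_ac)
    qed
    then show ?thesis by blast
  qed
  define t where "t = Inf U"
  have tU: "x \<bullet> (M *\<^sub>v x) \<le> t * (x \<bullet> (N *\<^sub>v x))" if x: "x \<in> carrier_vec n" for x
  proof (cases "x = 0\<^sub>v n")
    case True
    then show ?thesis using M N by simp
  next
    case False
    have "x \<bullet> (M *\<^sub>v x) / (x \<bullet> (N *\<^sub>v x)) \<le> t"
      unfolding t_def using ne ratio_le[OF x False] by (rule cInf_greatest)
    then show ?thesis using posN[OF x False] by (simp add: divide_le_eq)
  qed
  define K where "K = t \<cdot>\<^sub>m N - M"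
  have K: "K \<in> carrier_mat n n" using M N unfolding K_def by (intro minus_carrier_mat)
  have Kv: "K *\<^sub>v x = t \<cdot>\<^sub>v (N *\<^sub>v x) - M *\<^sub>v x" if "x \<in> carrier_vec n" for x
    using M N that by (simp add: K_def minus_mult_distrib_mat_vec[of _ n n] smult_mult_mat_vec)
  have Kq: "x \<bullet> (K *\<^sub>v x) = t * (x \<bullet> (N *\<^sub>v x)) - x \<bullet> (M *\<^sub>v x)" if "x \<in> carrier_vec n" for x
    using M N that by (simp add: Kv scalar_prod_minus_distrib[of _ n])
  have "(t \<cdot>\<^sub>m N)\<^sup>T = t \<cdot>\<^sub>m N\<^sup>T" by (intro eq_matI) auto
  then have "sym_mat K"
    using M N by (auto simp: sym_mat_def spd_mat_def K_def transpose_minus[of _ n n])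
  then have Kspsd: "spsd_mat K" using K tU by (auto simp: spsd_mat_def Kq)
  have "det K = 0"
  proof (rule ccontr)
    assume "det K \<noteq> 0"
    from spsd_mat_coercive[OF Kspsd K this]
    obtain C where C: "0 < C" "\<And>x. x \<in> carrier_vec n \<Longrightarrow> x \<bullet> x \<le> C * (x \<bullet> (K *\<^sub>v x))" by blast
    from quadratic_form_bounded[OF N(2)] obtain D where
      D: "0 < D" "\<And>x. x \<in> carrier_vec n \<Longrightarrow> x \<bullet> (N *\<^sub>v x) \<le> D * (x \<bullet> x)" by blast
    \<comment> \<open>From \<open>x \<bullet> (N x) \<le> D * C * (x \<bullet> (K x))\<close> the
      amount by which \<open>t\<close> can be lowered is \<open>1 / (D * C)\<close>.\<close>
    have "t - 1 / (D * C) \<in> U"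
      unfolding U_def
    proof (safe)
      fix x :: "real vec" assume x: "x \<in> carrier_vec n"
      have "x \<bullet> (N *\<^sub>v x) \<le> D * (x \<bullet> x)" by (rule D(2)[OF x])
      also have "\<dots> \<le> D * (C * (x \<bullet> (K *\<^sub>v x)))" using C(2)[OF x] D(1) by simp
      finally show "x \<bullet> (M *\<^sub>v x) \<le> (t - 1 / (D * C)) * (x \<bullet> (N *\<^sub>v x))"
        using C(1) D(1) x by (simp add: Kq field_simps)
    qed
    from cInf_lower[OF this bdd] mult_pos_pos[OF D(1) C(1)] show False by (simp add: t_def)
  qed
  then obtain v where v: "v \<in> carrier_vec n" "v \<noteq> 0\<^sub>v n" "K *\<^sub>v v = 0\<^sub>v n"
    using det_0_iff_vec_prod_zero_field[OF K] by blast
  have "M *\<^sub>v v = t \<cdot>\<^sub>v (N *\<^sub>v v)"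
  proof (rule eq_vecI)
    fix i assume "i < dim_vec (t \<cdot>\<^sub>v (N *\<^sub>v v))"
    then have i: "i < n" using N by simp
    have "(t \<cdot>\<^sub>v (N *\<^sub>v v) - M *\<^sub>v v) $ i = 0" using v i Kv by simp
    then show "(M *\<^sub>v v) $ i = (t \<cdot>\<^sub>v (N *\<^sub>v v)) $ i" using i M N by simp
  qed (use M N in simp)
  from that[OF v(1,2) this tU] show ?thesis .
qed

text \<open>Cancel the invertible \<open>N\<close>. Writing the pencil with \<open>N * T\<close>
  relates a symmetric pair to a generally nonsymmetric \<open>T\<close>, as with
  \<open>S_inex\<close> and \<open>mat_inv S_inex * S\<close>.\<close>

lemma eigenvalue_of_pencil:
  fixes N T :: "real mat"
  assumes N: "spd_mat N" "N \<in> carrier_mat n n" and T: "T \<in> carrier_mat n n"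
    and v: "v \<in> carrier_vec n" "v \<noteq> 0\<^sub>v n" "(N * T) *\<^sub>v v = \<mu> \<cdot>\<^sub>v (N *\<^sub>v v)"
  shows "\<mu> \<in> spectrum T"
proof -
  note inv = mat_inv_carrier_inverts[OF N(2) spd_mat_det_nonzero[OF N]]
  have "T *\<^sub>v v = (mat_inv N * N) *\<^sub>v (T *\<^sub>v v)" using inv T v by simp
  also have "\<dots> = mat_inv N *\<^sub>v (N *\<^sub>v (T *\<^sub>v v))" using inv N T v by (intro assoc_mult_mat_vec) auto
  also have "N *\<^sub>v (T *\<^sub>v v) = \<mu> \<cdot>\<^sub>v (N *\<^sub>v v)" using N T v by simp
  also have "mat_inv N *\<^sub>v (\<mu> \<cdot>\<^sub>v (N *\<^sub>v v)) = \<mu> \<cdot>\<^sub>v (mat_inv N *\<^sub>v (N *\<^sub>v v))"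
    using inv N v by (simp add: mult_mat_vec[of _ n n])
  also have "mat_inv N *\<^sub>v (N *\<^sub>v v) = v"
    using inv N v by (simp flip: assoc_mult_mat_vec)
  finally show ?thesis using T v by (auto simp: spectrum_def eigenvalue_def eigenvector_def)
qed

text \<open>The Rayleigh quotient of \<open>N * T\<close> with weight \<open>N\<close> attains its
  maximum at an eigenvector of \<open>T\<close>, so the maximum is at most
  \<open>lambda_max T\<close>. The minimum is treated as the maximum for \<open>- (N * T)\<close>.
  Attainment also makes the spectrum nonempty, so that \<open>Max\<close> and \<open>Min\<close>
  yield genuine eigenvalues.\<close>

lemma rayleigh_bounds:
  assumes n: "0 < n" and N: "spd_mat N" "N \<in> carrier_mat n n"
    and T: "T \<in> carrier_mat n n" and M: "sym_mat (N * T)"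
  shows "lambda_max T \<in> spectrum T"
    and "x \<in> carrier_vec n \<Longrightarrow> x \<bullet> ((N * T) *\<^sub>v x) \<le> lambda_max T * (x \<bullet> (N *\<^sub>v x))"
    and "x \<in> carrier_vec n \<Longrightarrow> lambda_min T * (x \<bullet> (N *\<^sub>v x)) \<le> x \<bullet> ((N * T) *\<^sub>v x)"
proof -
  let ?M = "N * T"
  have Mc: "?M \<in> carrier_mat n n" using N T by simp
  note fin = card_finite_spectrum(1)[OF T]
  have qN: "0 \<le> x \<bullet> (N *\<^sub>v x)" if "x \<in> carrier_vec n" for x
    using spd_mat_imp_spsd_mat[OF N(1)] N(2) that by (auto simp: spsd_mat_def)
  obtain \<mu> v where v: "v \<in> carrier_vec n" "v \<noteq> 0\<^sub>v n" "?M *\<^sub>v v = \<mu> \<cdot>\<^sub>v (N *\<^sub>v v)"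
    and up: "\<And>x. x \<in> carrier_vec n \<Longrightarrow> x \<bullet> (?M *\<^sub>v x) \<le> \<mu> * (x \<bullet> (N *\<^sub>v x))"
    using max_rayleigh_quotient_attained[OF n N M Mc] by blast
  have mu: "\<mu> \<in> spectrum T" by (rule eigenvalue_of_pencil[OF N T v])
  then show "lambda_max T \<in> spectrum T" unfolding lambda_max_def using fin by (intro Max_in) auto
  have "\<mu> \<le> lambda_max T" unfolding lambda_max_def using fin mu by simp
  then show "x \<bullet> (?M *\<^sub>v x) \<le> lambda_max T * (x \<bullet> (N *\<^sub>v x))" if x: "x \<in> carrier_vec n"
    using up[OF x] qN[OF x] by (meson mult_right_mono order_trans)
  have M': "sym_mat (- ?M)" using M by (simp add: sym_mat_def transpose_uminus)
  have neg: "(- ?M) *\<^sub>v x = - (?M *\<^sub>v x)" if "x \<in> carrier_vec n" for x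
    using that T by (intro uminus_mult_mat_vec) simp
  obtain \<nu> w where w: "w \<in> carrier_vec n" "w \<noteq> 0\<^sub>v n" "(- ?M) *\<^sub>v w = \<nu> \<cdot>\<^sub>v (N *\<^sub>v w)"
    and lo: "\<And>x. x \<in> carrier_vec n \<Longrightarrow> x \<bullet> ((- ?M) *\<^sub>v x) \<le> \<nu> * (x \<bullet> (N *\<^sub>v x))"
    using max_rayleigh_quotient_attained[OF n N M'] Mc by (metis uminus_carrier_mat)
  have "?M *\<^sub>v w = - ((- ?M) *\<^sub>v w)" using neg[OF w(1)] Mc by simp
  also have "\<dots> = (- \<nu>) \<cdot>\<^sub>v (N *\<^sub>v w)" unfolding w(3) by auto
  finally have nu: "- \<nu> \<in> spectrum T" using eigenvalue_of_pencil[OF N T w(1,2)] by blast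
  then have le: "lambda_min T \<le> - \<nu>" unfolding lambda_min_def using fin by simp
  show "lambda_min T * (x \<bullet> (N *\<^sub>v x)) \<le> x \<bullet> (?M *\<^sub>v x)" if x: "x \<in> carrier_vec n"
  proof -
    have "lambda_min T * (x \<bullet> (N *\<^sub>v x)) \<le> - \<nu> * (x \<bullet> (N *\<^sub>v x))"
      using le qN[OF x] by (rule mult_right_mono)
    also have "\<dots> \<le> x \<bullet> (?M *\<^sub>v x)"
      using lo[OF x] unfolding neg[OF x] using Mc x by (subst (asm) scalar_prod_uminus_right) auto
    finally show ?thesis .
  qed
qed

text \<open>\<open>mat_norm2\<close> is a supremum of reals, so it bounds its members only once they
  are known to be bounded above; \<open>c > 0\<close> provides a unit vector and hence
  nonnegativity. The estimate for general \<open>x\<close> follows by normalising.\<close>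

lemma mat_norm2_bound:
  assumes M: "M \<in> carrier_mat r c" and c: "0 < c"
  shows "0 \<le> mat_norm2 M"
    and "x \<in> carrier_vec c \<Longrightarrow> (M *\<^sub>v x) \<bullet> (M *\<^sub>v x) \<le> (mat_norm2 M)^2 * (x \<bullet> x)"
proof -
  let ?V = "{v \<in> carrier_vec (dim_col M). vec_norm2 v = 1}"
  from mult_mat_vec_bounded[OF M] obtain C where C: "0 < C"
    and le: "\<And>x. x \<in> carrier_vec c \<Longrightarrow> (M *\<^sub>v x) \<bullet> (M *\<^sub>v x) \<le> C * (x \<bullet> x)" by blast
  have bdd: "bdd_above ((\<lambda>v. vec_norm2 (M *\<^sub>v v)) ` ?V)"
  proof (rule bdd_aboveI2)
    fix v assume "v \<in> ?V"
    with le[of v] M show "vec_norm2 (M *\<^sub>v v) \<le> sqrt C"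
      by (auto simp: vec_norm2_def)
  qed
  have upper: "vec_norm2 (M *\<^sub>v v) \<le> mat_norm2 M" if "v \<in> carrier_vec c" "vec_norm2 v = 1" for v
    unfolding mat_norm2_def using bdd M that by (intro cSUP_upper) auto
  have nonneg: "0 \<le> vec_norm2 v" for v by (simp add: vec_norm2_def scalar_prod_self_nonneg)
  have "vec_norm2 (unit_vec c 0) = 1" using c by (simp add: vec_norm2_def)
  from order_trans[OF nonneg upper[OF _ this]] show nn: "0 \<le> mat_norm2 M" by simp
  assume x: "x \<in> carrier_vec c"
  show "(M *\<^sub>v x) \<bullet> (M *\<^sub>v x) \<le> (mat_norm2 M)^2 * (x \<bullet> x)"
  proof (cases "x = 0\<^sub>v c")
    case True
    then have "M *\<^sub>v x = 0\<^sub>v r" using M by auto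
    then show ?thesis by (simp add: scalar_prod_self_nonneg)
  next
    case False
    define s where "s = sqrt (x \<bullet> x)"
    have s: "0 < s" "s^2 = x \<bullet> x" using scalar_prod_self_pos[OF x False] by (auto simp: s_def)
    let ?u = "(1 / s) \<cdot>\<^sub>v x"
    have u: "?u \<in> carrier_vec c" "?u \<bullet> ?u = 1"
      using x s by (auto simp: s(2)[symmetric] power2_eq_square)
    have "(M *\<^sub>v ?u) \<bullet> (M *\<^sub>v ?u) = (vec_norm2 (M *\<^sub>v ?u))^2"
      by (simp add: vec_norm2_def scalar_prod_self_nonneg)
    also have "\<dots> \<le> (mat_norm2 M)^2"
      using upper[OF u(1)] u(2) nonneg by (intro power_mono) (auto simp: vec_norm2_def)
    finally have "(M *\<^sub>v ?u) \<bullet> (M *\<^sub>v ?u) \<le> (mat_norm2 M)^2" .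
    moreover have "(M *\<^sub>v ?u) \<bullet> (M *\<^sub>v ?u) = (M *\<^sub>v x) \<bullet> (M *\<^sub>v x) / s^2"
      using M x by (simp add: mult_mat_vec[of _ r c] power2_eq_square)
    ultimately show ?thesis using s(1) unfolding s(2)[symmetric] by (simp add: divide_le_eq)
  qed
qed

subsection \<open>Non-real eigenvalues of selfadjoint matrices in an indefinite inner product\<close>

definition conj_transpose :: "complex mat \<Rightarrow> complex mat" where
  "conj_transpose W = map_mat cnj W\<^sup>T"

lemma conj_transpose_carrier [simp]:
  "W \<in> carrier_mat r c \<Longrightarrow> conj_transpose W \<in> carrier_mat c r"
  by (simp add: conj_transpose_def)

lemma conj_transpose_mult:
  assumes "A \<in> carrier_mat r k" "B \<in> carrier_mat k c"
  shows "conj_transpose (A * B) = conj_transpose B * conj_transpose A"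
  using assms by (intro eq_matI) (auto simp: conj_transpose_def scalar_prod_def mult.commute)

lemma scalar_prod_conj_transpose:
  assumes W: "W \<in> carrier_mat r c" and u: "u \<in> carrier_vec c" and v: "v \<in> carrier_vec r"
  shows "map_vec cnj (W *\<^sub>v u) \<bullet> v = map_vec cnj u \<bullet> (conj_transpose W *\<^sub>v v)"
proof -
  have *: "map_vec cnj (W *\<^sub>v u) = map_mat cnj W *\<^sub>v map_vec cnj u"
    using W u by (intro eq_vecI) (auto simp: scalar_prod_def)
  have "(map_mat cnj W *\<^sub>v map_vec cnj u) \<bullet> v = ((conj_transpose W)\<^sup>T *\<^sub>v map_vec cnj u) \<bullet> v"
    using W by (simp add: conj_transpose_def map_mat_transpose)
  also have "\<dots> = map_vec cnj u \<bullet> (conj_transpose W *\<^sub>v v)"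
    using W u v by (intro transpose_vec_mult_scalar[of _ c r]) auto
  finally show ?thesis unfolding * .
qed

text \<open>Triangularity lets entry \<open>(i, j)\<close> of the equation involve, besides
  \<open>K $$ (i, j)\<close>, only entries of \<open>K\<close> with a smaller index sum. By
  induction these vanish, and what remains is \<open>K $$ (i, j)\<close> times a nonzero difference
  of diagonal entries.\<close>

lemma triangular_intertwiner_zero:
  assumes B: "B \<in> carrier_mat n n" "upper_triangular B" and K: "K \<in> carrier_mat n n"
    and eq: "K * B = conj_transpose B * K" and k: "k \<le> n"
    and ne: "\<And>i j. i < k \<Longrightarrow> j < k \<Longrightarrow> B $$ (j, j) \<noteq> cnj (B $$ (i, i))"
  shows "i < k \<Longrightarrow> j < k \<Longrightarrow> K $$ (i, j) = 0"
proof (induction "i + j" arbitrary: i j rule: less_induct)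
  case less
  then have i: "i < n" and j: "j < n" using k by auto
  have zero: "B $$ (l, j) = 0" if "j < l" "l < n" for l j
    using B that by (auto simp: upper_triangular_def)
  have "(K * B) $$ (i, j) = (\<Sum>l<n. K $$ (i, l) * B $$ (l, j))"
    using B K i j by (simp add: scalar_prod_def atLeast0LessThan)
  also have "\<dots> = (\<Sum>l\<in>{j}. K $$ (i, l) * B $$ (l, j))"
  proof (intro sum.mono_neutral_right ballI)
    fix l assume l: "l \<in> {..<n} - {j}"
    then consider "l < j" | "j < l" by force
    then show "K $$ (i, l) * B $$ (l, j) = 0"
      by cases (use less l zero in auto)
  qed (use j in auto)
  finally have left: "(K * B) $$ (i, j) = K $$ (i, j) * B $$ (j, j)" by simp
  have "(conj_transpose B * K) $$ (i, j) = (\<Sum>l<n. cnj (B $$ (l, i)) * K $$ (l, j))"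
    using B K i j by (simp add: scalar_prod_def atLeast0LessThan conj_transpose_def)
  also have "\<dots> = (\<Sum>l\<in>{i}. cnj (B $$ (l, i)) * K $$ (l, j))"
  proof (intro sum.mono_neutral_right ballI)
    fix l assume l: "l \<in> {..<n} - {i}"
    then consider "l < i" | "i < l" by force
    then show "cnj (B $$ (l, i)) * K $$ (l, j) = 0"
      by cases (use less l zero in auto)
  qed (use i in auto)
  finally have "(conj_transpose B * K) $$ (i, j) = K $$ (i, j) * cnj (B $$ (i, i))" by simp
  with left eq have "K $$ (i, j) * (B $$ (j, j) - cnj (B $$ (i, i))) = 0"
    by (auto simp: right_diff_distrib)
  then show ?case using ne[OF less.prems] by (metis mult_eq_0_iff right_minus_eq)
qed

text \<open>The \<open>m\<close> equations are padded with zero rows to a square matrix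
  \<open>Y\<close>. Since \<open>m < k\<close>, the row with index \<open>m\<close> is zero, so the
  transpose kills a unit vector and \<open>det Y = 0\<close>.\<close>

lemma underdetermined_kernel:
  fixes a :: "nat \<Rightarrow> nat \<Rightarrow> complex"
  assumes "m < k"
  obtains c where "c \<in> carrier_vec k" "c \<noteq> 0\<^sub>v k" "\<And>i. i < m \<Longrightarrow> (\<Sum>j<k. a i j * c $ j) = 0"
proof -
  define Y where "Y = mat k k (\<lambda>(i, j). if i < m then a i j else 0)"
  have Y: "Y \<in> carrier_mat k k" by (simp add: Y_def)
  have "Y\<^sup>T *\<^sub>v unit_vec k m = 0\<^sub>v k"
    using assms by (intro eq_vecI) (auto simp: Y_def scalar_prod_def unit_vec_def intro!: sum.neutral)
  moreover have "unit_vec k m \<noteq> (0\<^sub>v k :: complex vec)" using assms by (rule unit_vec_nonzero)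
  ultimately have "det Y\<^sup>T = 0"
    using det_0_iff_vec_prod_zero_field[of "Y\<^sup>T" k] Y by (metis transpose_carrier_mat unit_vec_carrier)
  then have "det Y = 0" using det_transpose[OF Y] by simp
  then obtain c where c: "c \<in> carrier_vec k" "c \<noteq> 0\<^sub>v k" "Y *\<^sub>v c = 0\<^sub>v k"
    using det_0_iff_vec_prod_zero_field[OF Y] by blast
  show ?thesis
  proof (rule that[OF c(1,2)])
    fix i assume i: "i < m"
    then have "(Y *\<^sub>v c) $ i = 0" using c(3) assms by simp
    then show "(\<Sum>j<k. a i j * c $ j) = 0"
      using i assms c(1) by (simp add: Y_def scalar_prod_def atLeast0LessThan)
  qed
qed

text \<open>The order of \<open>z\<close> is the number of its occurrences in \<open>as\<close>, so
  distinct elements of \<open>F\<close> count disjoint sets of list positions, all of them kept by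
  the filter.\<close>

lemma sum_order_le_length_filter:
  fixes as :: "complex list"
  assumes p: "p = (\<Prod>a\<leftarrow>as. [:- a, 1:])" and F: "finite F" "F \<subseteq> U"
  shows "(\<Sum>z\<in>F. Polynomial.order z p) \<le> length (filter (\<lambda>z. z \<in> U) as)"
proof -
  have "Polynomial.order z p = (\<Sum>a\<leftarrow>as. if z = a then 1 else 0)" for z
    unfolding p by (subst order_prod_list) (auto simp: o_def order_linear' intro!: arg_cong[of _ _ sum_list])
  then have "(\<Sum>z\<in>F. Polynomial.order z p) = (\<Sum>z\<in>F. \<Sum>a\<leftarrow>as. if z = a then 1 else 0)"
    by simp
  also have "\<dots> \<le> length (filter (\<lambda>z. z \<in> U) as)"
  proof (induction as)
    case (Cons a as)
    have "(\<Sum>z\<in>F. if z = a then 1 else 0 :: nat) \<le> (if a \<in> U then 1 else 0)"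
      using F by (auto simp: sum.delta)
    then have "(\<Sum>z\<in>F. if z = a then 1 else 0 :: nat) + (\<Sum>z\<in>F. \<Sum>a\<leftarrow>as. if z = a then 1 else 0)
        \<le> (if a \<in> U then 1 else 0) + length (filter (\<lambda>z. z \<in> U) as)"
      using Cons by (rule add_mono)
    then show ?case by (simp add: sum.distrib split: if_splits)
  qed simp
  finally show ?thesis .
qed

text \<open>The Schur basis vectors belonging to eigenvalues in \<open>U\<close> span a subspace on which the
  Hermitian form \<open>J\<close> vanishes: its Gram matrix intertwines the triangular factor with the
  adjoint of that factor, and these have no common eigenvalue. A form that is definite on
  the first \<open>n\<close> coordinates admits no such subspace of dimension larger than \<open>m\<close>.\<close>

lemma sum_order_conj_free_le:
  fixes J M :: "complex mat"
  assumes J: "J \<in> carrier_mat (n + m) (n + m)" and M: "M \<in> carrier_mat (n + m) (n + m)"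
    and sa: "conj_transpose M * J = J * M"
    and definite: "\<And>v. v \<in> carrier_vec (n + m) \<Longrightarrow> v \<noteq> 0\<^sub>v (n + m) \<Longrightarrow>
      (\<And>i. n \<le> i \<Longrightarrow> i < n + m \<Longrightarrow> v $ i = 0) \<Longrightarrow> map_vec cnj v \<bullet> (J *\<^sub>v v) \<noteq> 0"
    and U: "\<And>a b. a \<in> U \<Longrightarrow> b \<in> U \<Longrightarrow> a \<noteq> cnj b"
  shows "(\<Sum>z\<in>{z. eigenvalue M z \<and> z \<in> U}. Polynomial.order z (char_poly M)) \<le> m"
proof -
  let ?N = "n + m"
  from char_poly_factorized[OF M] obtain as where
    as: "char_poly M = (\<Prod>a\<leftarrow>as. [:- a, 1:])" "length as = ?N" by blast
  let ?us = "filter (\<lambda>z. z \<in> U) as"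
  \<comment> \<open>The roots in \<open>U\<close> come first: the Schur decomposition keeps the
    given order on the diagonal, so the first \<open>k\<close> columns of \<open>W\<close> span an
    invariant subspace for the eigenvalues in \<open>U\<close>.\<close>
  define es where "es = ?us @ filter (\<lambda>z. z \<notin> U) as"
  define k where "k = length ?us"
  have "mset es = mset as" unfolding es_def mset_append mset_filter by (rule multiset_partition[symmetric])
  then have "mset (map (\<lambda>a. [:- a, 1:]) es) = mset (map (\<lambda>a. [:- a, 1:]) as)" by simp
  then have es: "char_poly M = (\<Prod>a\<leftarrow>es. [:- a, 1:])"
    unfolding as by (metis prod_mset_prod_list)
  obtain B W V where dec: "schur_decomposition M es = (B, W, V)"
    by (cases "schur_decomposition M es") auto
  from schur_decomposition[OF M es dec]
  have sim: "similar_mat_wit M B W V" and ut: "upper_triangular B" and diag: "diag_mat B = es"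
    by auto
  from similar_mat_witD2[OF M sim]
  have WV: "W * V = 1\<^sub>m ?N" "V * W = 1\<^sub>m ?N" "M = W * B * V"
    and c: "B \<in> carrier_mat ?N ?N" "W \<in> carrier_mat ?N ?N" "V \<in> carrier_mat ?N ?N" by auto
  note assoc = assoc_mult_mat[of _ ?N ?N _ ?N _ ?N]
  have MW: "M * W = W * B"
  proof -
    have "M * W = W * B * (V * W)" 
      unfolding WV(3) using c by (simp add: assoc)
    then show ?thesis using WV c by simp
  qed
  have len: "length es = ?N" using diag c(1) by (auto simp: diag_mat_def)
  have k: "k \<le> ?N" using as(2) length_filter_le[of "\<lambda>z. z \<in> U" as] by (simp add: k_def)
  have BU: "B $$ (i, i) \<in> U" if "i < k" for i
  proof -
    have "B $$ (i, i) = es ! i"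
      using diag c(1) that k by (auto simp: diag_mat_def)
    also have "\<dots> = ?us ! i" using that by (simp add: es_def k_def nth_append)
    also have "\<dots> \<in> U" using that nth_mem[of i ?us] by (simp add: k_def)
    finally show ?thesis .
  qed
  let ?W = "conj_transpose W"
  define K where "K = ?W * (J * W)"
  have K: "K \<in> carrier_mat ?N ?N" 
    unfolding K_def using c J by (intro mult_carrier_mat[of _ _ ?N]) auto
  have "K * B = ?W * (J * (W * B))" using c J by (simp add: K_def assoc)
  also have "\<dots> = ?W * ((J * M) * W)" using c J M by (simp add: assoc flip: MW)
  also have "\<dots> = (?W * conj_transpose M) * (J * W)" 
    unfolding sa[symmetric] using c J M by (simp add: assoc)
  also have "?W * conj_transpose M = conj_transpose B * ?W"
    using conj_transpose_mult[OF M c(2)] conj_transpose_mult[OF c(2,1)] MW by simp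
  also have "conj_transpose B * ?W * (J * W) = conj_transpose B * K"
    using c J by (simp add: K_def assoc)
  finally have KB: "K * B = conj_transpose B * K" .
  have K0: "K $$ (i, j) = 0" if "i < k" "j < k" for i j
    using triangular_intertwiner_zero[OF c(1) ut K KB k _ that] U BU by blast
  have "k \<le> m"
  proof (rule ccontr)
    assume "\<not> k \<le> m"
    then have "m < k" by simp
    \<comment> \<open>A nontrivial combination of the first \<open>k\<close> columns of
      \<open>W\<close> whose last \<open>m\<close> coordinates vanish; \<open>e\<close> below pads
      its coefficients with zeros.\<close>
    then obtain d where d: "d \<in> carrier_vec k" "d \<noteq> 0\<^sub>v k"
      and ker: "\<And>i. i < m \<Longrightarrow> (\<Sum>j<k. W $$ (n + i, j) * d $ j) = 0"
      using underdetermined_kernel[of m k "\<lambda>i j. W $$ (n + i, j)"] by blast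
    define e where "e = vec ?N (\<lambda>j. if j < k then d $ j else 0)"
    have e: "e \<in> carrier_vec ?N" by (simp add: e_def)
    have e0: "e \<noteq> 0\<^sub>v ?N"
    proof
      assume "e = 0\<^sub>v ?N"
      then have "e $ j = 0" if "j < k" for j using that k by simp
      then have "d $ j = 0" if "j < k" for j using that k by (simp add: e_def)
      then show False using d by auto
    qed
    have sum_e: "(\<Sum>j<?N. f j * e $ j) = (\<Sum>j<k. f j * d $ j)" for f
      using k by (intro sum.mono_neutral_cong_right) (auto simp: e_def)
    let ?v = "W *\<^sub>v e"
    have v: "?v \<in> carrier_vec ?N" using c e by simp
    have "?v \<noteq> 0\<^sub>v ?N"
    proof
      assume "?v = 0\<^sub>v ?N"
      then have "V *\<^sub>v (W *\<^sub>v e) = 0\<^sub>v ?N" using c by auto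
      moreover have "V *\<^sub>v (W *\<^sub>v e) = e"
        using assoc_mult_mat_vec[OF c(3,2) e] WV(2) e by simp
      ultimately show False using e0 by simp
    qed
    moreover have "?v $ i = 0" if "n \<le> i" "i < ?N" for i
      using ker[of "i - n"] sum_e[of "\<lambda>j. W $$ (i, j)"] that c e
      by (simp add: scalar_prod_def atLeast0LessThan)
    \<comment> \<open>Only coefficients with index below \<open>k\<close> are nonzero, and on these
      indices the Gram matrix \<open>K\<close> vanishes.\<close>
    moreover have "map_vec cnj ?v \<bullet> (J *\<^sub>v ?v) = 0"
    proof -
      have "map_vec cnj ?v \<bullet> (J *\<^sub>v ?v) = map_vec cnj e \<bullet> (K *\<^sub>v e)"
        using scalar_prod_conj_transpose[OF c(2) e, of "J *\<^sub>v ?v"] c J e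
        by (simp add: K_def assoc_mult_mat_vec[of _ ?N ?N _ ?N])
      also have "\<dots> = 0"
        unfolding scalar_prod_def
      proof (intro sum.neutral ballI)
        fix i assume "i \<in> {0..<dim_vec (K *\<^sub>v e)}"
        then have i: "i < ?N" using K by simp
        show "map_vec cnj e $ i * (K *\<^sub>v e) $ i = 0"
        proof (cases "i < k")
          case True
          have "(K *\<^sub>v e) $ i = (\<Sum>j<?N. K $$ (i, j) * e $ j)"
            using K e i by (simp add: scalar_prod_def atLeast0LessThan)
          then show ?thesis using True K0 by (simp add: sum_e)
        qed (use i in \<open>simp add: e_def\<close>)
      qed
      finally show ?thesis .
    qed
    ultimately show False using definite[OF v] by blast
  qed
  moreover have "finite {z. eigenvalue M z \<and> z \<in> U}"
    using card_finite_spectrum(1)[OF M] by (auto simp: spectrum_def)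
  then have "(\<Sum>z\<in>{z. eigenvalue M z \<and> z \<in> U}. Polynomial.order z (char_poly M)) \<le> k"
    unfolding k_def by (intro sum_order_le_length_filter[OF as(1)]) auto
  ultimately show ?thesis by simp
qed

text \<open>Symmetry of \<open>P * M\<close> makes \<open>M\<close> selfadjoint for the form
  \<open>P\<close>. Neither open half-plane contains a point together with its conjugate, so each
  contributes at most \<open>m\<close> to the count.\<close>

lemma num_nonreal_eigenvalues_le:
  fixes P M :: "real mat"
  assumes P: "P \<in> carrier_mat (n + m) (n + m)" and M: "M \<in> carrier_mat (n + m) (n + m)"
    and symP: "P\<^sup>T = P" and symPM: "(P * M)\<^sup>T = P * M"
    and definite: "\<And>v. v \<in> carrier_vec (n + m) \<Longrightarrow> v \<noteq> 0\<^sub>v (n + m) \<Longrightarrow>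
      (\<And>i. n \<le> i \<Longrightarrow> i < n + m \<Longrightarrow> v $ i = 0) \<Longrightarrow> map_vec cnj v \<bullet> (cmat P *\<^sub>v v) \<noteq> 0"
  shows "num_nonreal_eigenvalues M \<le> 2 * m"
proof -
  let ?M = "cmat M" and ?ord = "\<lambda>z. Polynomial.order z (char_poly (cmat M))"
  have cM: "?M \<in> carrier_mat (n + m) (n + m)" and cP: "cmat P \<in> carrier_mat (n + m) (n + m)"
    using M P by auto
  have "conj_transpose ?M = cmat M\<^sup>T" by (intro eq_matI) (auto simp: conj_transpose_def)
  then have "conj_transpose ?M * cmat P = cmat (M\<^sup>T * P)"
  proof -
    have "cmat (M\<^sup>T * P) = cmat M\<^sup>T * cmat P"
      using M P of_real_hom.mat_hom_mult transpose_carrier_mat by blast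
    then show ?thesis using \<open>conj_transpose ?M = cmat M\<^sup>T\<close> by simp
  qed
  also have "M\<^sup>T * P = P * M" using symPM transpose_mult[OF P M] symP by simp
  also have "cmat (P * M) = cmat P * ?M" using M P of_real_hom.mat_hom_mult by blast
  finally have sa: "conj_transpose ?M * cmat P = cmat P * ?M" .
  have fin: "finite {z. eigenvalue ?M z \<and> Q z}" for Q
    using card_finite_spectrum(1)[OF cM] by (auto simp: spectrum_def)
  have up: "(\<Sum>z\<in>{z. eigenvalue ?M z \<and> z \<in> {z. 0 < Im z}}. ?ord z) \<le> m"
    by (rule sum_order_conj_free_le[OF cP cM sa definite]) auto
  have lo: "(\<Sum>z\<in>{z. eigenvalue ?M z \<and> z \<in> {z. Im z < 0}}. ?ord z) \<le> m"
    by (rule sum_order_conj_free_le[OF cP cM sa definite]) auto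
  have "{z. eigenvalue ?M z \<and> Im z \<noteq> 0} =
      {z. eigenvalue ?M z \<and> z \<in> {z. 0 < Im z}} \<union> {z. eigenvalue ?M z \<and> z \<in> {z. Im z < 0}}"
    by auto
  then have "num_nonreal_eigenvalues M =
      (\<Sum>z\<in>{z. eigenvalue ?M z \<and> z \<in> {z. 0 < Im z}}. ?ord z) +
      (\<Sum>z\<in>{z. eigenvalue ?M z \<and> z \<in> {z. Im z < 0}}. ?ord z)"
    unfolding num_nonreal_eigenvalues_def using fin by (simp add: sum.union_disjoint disjoint_iff)
  with up lo show ?thesis by simp
qed

subsection \<open>Form identities of the pencil\<close>

text \<open>Splitting leaves equations between real vectors, to which the real quadratic forms and
  Rayleigh bounds apply.\<close>

lemma real_imag_parts_of_pencil:
  assumes M: "M \<in> carrier_mat k k" and P: "P \<in> carrier_mat k k" and v: "v \<in> carrier_vec k"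
    and eq: "cmat M *\<^sub>v v = z \<cdot>\<^sub>v (cmat P *\<^sub>v v)"
  shows "M *\<^sub>v map_vec Re v = Re z \<cdot>\<^sub>v (P *\<^sub>v map_vec Re v) - Im z \<cdot>\<^sub>v (P *\<^sub>v map_vec Im v)"
    and "M *\<^sub>v map_vec Im v = Re z \<cdot>\<^sub>v (P *\<^sub>v map_vec Im v) + Im z \<cdot>\<^sub>v (P *\<^sub>v map_vec Re v)"
proof -
  have parts: "(N *\<^sub>v map_vec Re v) $ i = Re ((cmat N *\<^sub>v v) $ i)"
    "(N *\<^sub>v map_vec Im v) $ i = Im ((cmat N *\<^sub>v v) $ i)"
    if "N \<in> carrier_mat k k" "i < k" for N i
    using that v by (auto simp: scalar_prod_def)
  have idx: "(cmat M *\<^sub>v v) $ i = z * (cmat P *\<^sub>v v) $ i" if "i < k" for i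
    unfolding eq using that P by (simp del: index_mult_mat_vec)
  show "M *\<^sub>v map_vec Re v = Re z \<cdot>\<^sub>v (P *\<^sub>v map_vec Re v) - Im z \<cdot>\<^sub>v (P *\<^sub>v map_vec Im v)"
    using M P by (intro eq_vecI) (simp_all add: parts idx del: index_mult_mat_vec)
  show "M *\<^sub>v map_vec Im v = Re z \<cdot>\<^sub>v (P *\<^sub>v map_vec Im v) + Im z \<cdot>\<^sub>v (P *\<^sub>v map_vec Re v)"
    using M P by (intro eq_vecI) (simp_all add: parts idx del: index_mult_mat_vec)
qed

text \<open>In the variables \<open>w = x + C y\<close> and \<open>y\<close> the pencil has a symmetric block diagonal and a
  skew-symmetric off-diagonal part, which cancels from the form identities below. The vectors
  with index 1 and 2 are the real and imaginary parts of an eigenvector for \<open>\<alpha> + i \<beta>\<close>.\<close>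

lemma pencil_form_identities:
  fixes G H C Th Si :: "real mat" and \<alpha> \<beta> :: real
  assumes G: "G \<in> carrier_mat n n" "sym_mat G" and H: "H \<in> carrier_mat n n" "sym_mat H"
    and C: "C \<in> carrier_mat n m"
    and Th: "Th \<in> carrier_mat m m" "sym_mat Th" and Si: "Si \<in> carrier_mat m m" "sym_mat Si"
    and w: "w1 \<in> carrier_vec n" "w2 \<in> carrier_vec n"
    and y: "y1 \<in> carrier_vec m" "y2 \<in> carrier_vec m"
    and c: "c1 = C *\<^sub>v y1" "c2 = C *\<^sub>v y2"
    and eq1: "H *\<^sub>v (w1 - c1) + G *\<^sub>v c1 = \<alpha> \<cdot>\<^sub>v (G *\<^sub>v w1) - \<beta> \<cdot>\<^sub>v (G *\<^sub>v w2)"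
    and eq2: "H *\<^sub>v (w2 - c2) + G *\<^sub>v c2 = \<alpha> \<cdot>\<^sub>v (G *\<^sub>v w2) + \<beta> \<cdot>\<^sub>v (G *\<^sub>v w1)"
    and eq3: "C\<^sup>T *\<^sub>v (G *\<^sub>v (w1 - c1)) - Th *\<^sub>v y1 =
      \<alpha> \<cdot>\<^sub>v (C\<^sup>T *\<^sub>v (G *\<^sub>v w1) - Si *\<^sub>v y1) - \<beta> \<cdot>\<^sub>v (C\<^sup>T *\<^sub>v (G *\<^sub>v w2) - Si *\<^sub>v y2)"
    and eq4: "C\<^sup>T *\<^sub>v (G *\<^sub>v (w2 - c2)) - Th *\<^sub>v y2 =
      \<alpha> \<cdot>\<^sub>v (C\<^sup>T *\<^sub>v (G *\<^sub>v w2) - Si *\<^sub>v y2) + \<beta> \<cdot>\<^sub>v (C\<^sup>T *\<^sub>v (G *\<^sub>v w1) - Si *\<^sub>v y1)"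
  defines "p \<equiv> w1 \<bullet> (G *\<^sub>v w1) + w2 \<bullet> (G *\<^sub>v w2)"
    and "q \<equiv> y1 \<bullet> (Si *\<^sub>v y1) + y2 \<bullet> (Si *\<^sub>v y2)"
    and "h \<equiv> (w1 \<bullet> (G *\<^sub>v c2) - w1 \<bullet> (H *\<^sub>v c2)) - (w2 \<bullet> (G *\<^sub>v c1) - w2 \<bullet> (H *\<^sub>v c1))"
  shows "w1 \<bullet> (H *\<^sub>v w1) + w2 \<bullet> (H *\<^sub>v w2)
      + ((2 * (c1 \<bullet> (G *\<^sub>v c1)) - c1 \<bullet> (H *\<^sub>v c1) + y1 \<bullet> (Th *\<^sub>v y1))
       + (2 * (c2 \<bullet> (G *\<^sub>v c2)) - c2 \<bullet> (H *\<^sub>v c2) + y2 \<bullet> (Th *\<^sub>v y2))) = \<alpha> * (p + q)"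
    and "h = \<beta> * p" and "h = \<beta> * q"
proof -
  have cc: "c1 \<in> carrier_vec n" "c2 \<in> carrier_vec n" using c C y by auto
  note sG = sym_mat_scalar_prod[OF G(2,1)] and sH = sym_mat_scalar_prod[OF H(2,1)]
    and sT = sym_mat_scalar_prod[OF Th(2,1)] and sS = sym_mat_scalar_prod[OF Si(2,1)]
  have r1: "z \<bullet> (H *\<^sub>v w1) - z \<bullet> (H *\<^sub>v c1) + z \<bullet> (G *\<^sub>v c1) = \<alpha> * (z \<bullet> (G *\<^sub>v w1)) - \<beta> * (z \<bullet> (G *\<^sub>v w2))"
    if z: "z \<in> carrier_vec n" for z
    using arg_cong[OF eq1, of "\<lambda>v. z \<bullet> v"] z G H w cc
    by (simp add: mult_minus_distrib_mat_vec[of _ n n] scalar_prod_minus_distrib[of _ n]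
        scalar_prod_add_distrib[of _ n])
  have r2: "z \<bullet> (H *\<^sub>v w2) - z \<bullet> (H *\<^sub>v c2) + z \<bullet> (G *\<^sub>v c2) = \<alpha> * (z \<bullet> (G *\<^sub>v w2)) + \<beta> * (z \<bullet> (G *\<^sub>v w1))"
    if z: "z \<in> carrier_vec n" for z
    using arg_cong[OF eq2, of "\<lambda>v. z \<bullet> v"] z G H w cc
    by (simp add: mult_minus_distrib_mat_vec[of _ n n] scalar_prod_minus_distrib[of _ n]
        scalar_prod_add_distrib[of _ n])
  have tr: "t \<bullet> (C\<^sup>T *\<^sub>v u) = (C *\<^sub>v t) \<bullet> u" if "t \<in> carrier_vec m" "u \<in> carrier_vec n" for t u
    using scalar_prod_transpose[of "C\<^sup>T" m n t u] C that by simp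
  have r3: "(C *\<^sub>v t) \<bullet> (G *\<^sub>v w1) - (C *\<^sub>v t) \<bullet> (G *\<^sub>v c1) - t \<bullet> (Th *\<^sub>v y1)
      = \<alpha> * ((C *\<^sub>v t) \<bullet> (G *\<^sub>v w1) - t \<bullet> (Si *\<^sub>v y1)) - \<beta> * ((C *\<^sub>v t) \<bullet> (G *\<^sub>v w2) - t \<bullet> (Si *\<^sub>v y2))"
    if t: "t \<in> carrier_vec m" for t
    using arg_cong[OF eq3, of "\<lambda>v. t \<bullet> v"] t G C w cc Th Si y
    by (simp add: mult_minus_distrib_mat_vec[of _ n n] scalar_prod_minus_distrib[of _ n]
        scalar_prod_minus_distrib[of _ m] tr)
  have r4: "(C *\<^sub>v t) \<bullet> (G *\<^sub>v w2) - (C *\<^sub>v t) \<bullet> (G *\<^sub>v c2) - t \<bullet> (Th *\<^sub>v y2)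
      = \<alpha> * ((C *\<^sub>v t) \<bullet> (G *\<^sub>v w2) - t \<bullet> (Si *\<^sub>v y2)) + \<beta> * ((C *\<^sub>v t) \<bullet> (G *\<^sub>v w1) - t \<bullet> (Si *\<^sub>v y1))"
    if t: "t \<in> carrier_vec m" for t
    using arg_cong[OF eq4, of "\<lambda>v. t \<bullet> v"] t G C w cc Th Si y
    by (simp add: mult_minus_distrib_mat_vec[of _ n n] scalar_prod_minus_distrib[of _ n]
        scalar_prod_minus_distrib[of _ m] scalar_prod_add_distrib[of _ m] tr)
  note R3 = r3[OF y(1), folded c] r3[OF y(2), folded c]
    and R4 = r4[OF y(1), folded c] r4[OF y(2), folded c]
  note sym = sG[OF w(2,1)] sG[OF cc(1) w(1)] sG[OF cc(1) w(2)] sG[OF cc(2) w(1)] sG[OF cc(2) w(2)]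
    sG[OF cc(2,1)] sH[OF w(2,1)] sH[OF cc(1) w(1)] sH[OF cc(1) w(2)] sH[OF cc(2) w(1)]
    sH[OF cc(2) w(2)] sH[OF cc(2,1)] sT[OF y(2,1)] sS[OF y(2,1)]
  \<comment> \<open>The first block equation is tested with \<open>w\<close> and with
    \<open>c\<close>; from the latter the second one, tested with \<open>y\<close>, is subtracted.
    The products of \<open>w\<close> with \<open>c\<close> cancel by symmetry of \<open>G\<close>
    and \<open>H\<close>, and so do the terms with \<open>\<beta>\<close>.\<close>
  show "w1 \<bullet> (H *\<^sub>v w1) + w2 \<bullet> (H *\<^sub>v w2)
      + ((2 * (c1 \<bullet> (G *\<^sub>v c1)) - c1 \<bullet> (H *\<^sub>v c1) + y1 \<bullet> (Th *\<^sub>v y1))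
       + (2 * (c2 \<bullet> (G *\<^sub>v c2)) - c2 \<bullet> (H *\<^sub>v c2) + y2 \<bullet> (Th *\<^sub>v y2))) = \<alpha> * (p + q)"
    using r1[OF w(1)] r2[OF w(2)] r1[OF cc(1)] r2[OF cc(2)] R3(1) R4(2)
    unfolding p_def q_def sym by (simp add: algebra_simps)
  \<comment> \<open>Testing the equation of one part with the vector of the other, and subtracting,
    leaves \<open>\<beta>\<close> times the diagonal terms. The same in \<open>y\<close> yields the
    same coupling \<open>h\<close>, whence \<open>p = q\<close> whenever \<open>\<beta>\<close> is
    nonzero.\<close>
  show "h = \<beta> * p"
    using r2[OF w(1)] r1[OF w(2)] unfolding h_def p_def sym by (simp add: algebra_simps)
  show "h = \<beta> * q"
    using R4(1) R3(2) r2[OF cc(1)] r1[OF cc(2)]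
    unfolding h_def q_def sym by (simp add: algebra_simps)
qed

text \<open>Cauchy-Schwarz in dimension \<open>2 n\<close> for the stacked vectors
  \<open>(e1, - e2)\<close> and \<open>(s2, s1)\<close>. It will bound the coupling term that
  determines the imaginary part.\<close>

lemma cross_scalar_prod_bound:
  fixes e1 e2 s1 s2 :: "real vec"
  assumes "e1 \<in> carrier_vec n" "e2 \<in> carrier_vec n" "s1 \<in> carrier_vec n" "s2 \<in> carrier_vec n"
  shows "(e1 \<bullet> s2 - e2 \<bullet> s1)^2 \<le> (e1 \<bullet> e1 + e2 \<bullet> e2) * (s1 \<bullet> s1 + s2 \<bullet> s2)"
proof -
  have "((e1 @\<^sub>v - e2) \<bullet> (s2 @\<^sub>v s1))^2
      \<le> ((e1 @\<^sub>v - e2) \<bullet> (e1 @\<^sub>v - e2)) * ((s2 @\<^sub>v s1) \<bullet> (s2 @\<^sub>v s1))"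
    using assms by (intro scalar_prod_cauchy_schwarz[of _ "n + n"]) auto
  then show ?thesis using assms by (simp add: scalar_prod_append[of _ n _ n] add.commute)
qed

subsection \<open>Eigenvalue bounds\<close>

lemma det_uminus_nonzero:
  fixes M :: "real mat"
  assumes "M \<in> carrier_mat n n" "det M \<noteq> 0"
  shows "det (- M) \<noteq> 0"
proof -
  have "- M = (- 1) \<cdot>\<^sub>m M" by (intro eq_matI) auto
  then show ?thesis using assms by (simp add: det_smult)
qed

lemma spd_mat_diag_pos:
  assumes "spd_mat M" "M \<in> carrier_mat n n" "i < n"
  shows "0 < M $$ (i, i)"
proof -
  have "0 < unit_vec n i \<bullet> (M *\<^sub>v unit_vec n i)"
    using assms(1-3) unit_vec_nonzero[OF assms(3)] by (simp add: spd_mat_def del: scalar_prod_left_unit)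
  then show ?thesis using assms scalar_prod_left_unit[of "M *\<^sub>v unit_vec n i" n i] by simp
qed

lemma spd_mat_one: "spd_mat (1\<^sub>m n)"
  by (auto simp: spd_mat_def sym_mat_def intro: scalar_prod_self_pos)

lemma spsd_add_spd:
  assumes "spsd_mat M" "M \<in> carrier_mat n n" "spd_mat N" "N \<in> carrier_mat n n"
  shows "spd_mat (M + N)"
proof -
  have "(M + N)\<^sup>T = M + N"
    using assms transpose_add[of M n n N] by (simp add: spsd_mat_def spd_mat_def sym_mat_def)
  then show ?thesis
    using assms
    by (auto simp: spd_mat_def spsd_mat_def sym_mat_def add_mult_distrib_mat_vec[of _ n n]
        scalar_prod_add_distrib[of _ n] intro!: add_nonneg_pos)
qed

lemma spsd_quadratic_nonneg:
  assumes "spsd_mat M" "M \<in> carrier_mat n n" "x \<in> carrier_vec n"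
  shows "0 \<le> x \<bullet> (M *\<^sub>v x)"
  using assms by (auto simp: spsd_mat_def)

lemma abs_le_of_scaled_square_le:
  fixes b c p :: real
  assumes "(b * p)^2 \<le> (c * p)^2" "0 < p" "0 \<le> c"
  shows "\<bar>b\<bar> \<le> c"
proof -
  from assms(1) have "\<bar>b * p\<bar> \<le> \<bar>c * p\<bar>" by (simp only: abs_le_square_iff)
  with assms(2,3) show ?thesis by (simp add: abs_mult)
qed

text \<open>\<open>a\<close> is the mean of \<open>f / p\<close> and \<open>b / q\<close> with
  weights \<open>p\<close> and \<open>q\<close>; the absence of division admits a vanishing weight.
  Equal weights serve non-real eigenvalues, \<open>q = 0\<close> serves eigenvectors with
  \<open>y = 0\<close>.\<close>

lemma weighted_mean_bounds:
  fixes a p q :: real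
  assumes f: "l1 * p \<le> f" "f \<le> u1 * p" and b: "l2 * q \<le> b" "b \<le> u2 * q"
    and eq: "f + b = a * (p + q)" and p: "0 \<le> p" and q: "0 \<le> q" and pq: "0 < p + q"
  shows "min l1 l2 \<le> a" and "a \<le> max u1 u2"
    and "p = q \<Longrightarrow> (l1 + l2) / 2 \<le> a" and "p = q \<Longrightarrow> a \<le> (u1 + u2) / 2"
    and "q = 0 \<Longrightarrow> l1 \<le> a" and "q = 0 \<Longrightarrow> a \<le> u1"
proof -
  have "min l1 l2 * (p + q) \<le> l1 * p + l2 * q"
    unfolding distrib_left using p q by (intro add_mono mult_right_mono) auto
  then have "min l1 l2 * (p + q) \<le> a * (p + q)" using f b eq by linarith
  then show "min l1 l2 \<le> a" using pq by simp
  have "u1 * p + u2 * q \<le> max u1 u2 * (p + q)"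
    unfolding distrib_left using p q by (intro add_mono mult_right_mono) auto
  then have "a * (p + q) \<le> max u1 u2 * (p + q)" using f b eq by linarith
  then show "a \<le> max u1 u2" using pq by simp
  have *: "(l1 + l2) * p \<le> (2 * a) * p" "(2 * a) * p \<le> (u1 + u2) * p" if "p = q"
    using f b eq that by (simp_all add: algebra_simps)
  show "p = q \<Longrightarrow> (l1 + l2) / 2 \<le> a" using *(1) pq by simp
  show "p = q \<Longrightarrow> a \<le> (u1 + u2) / 2" using *(2) pq by simp
  show "q = 0 \<Longrightarrow> l1 \<le> a" "q = 0 \<Longrightarrow> a \<le> u1"
    using order_trans[OF f(1), of "a * p"] order_trans[OF _ f(2), of "a * p"] b eq pq by auto
qed

theorem theorem2p1:
  fixes m n :: nat
    and Q A \<Theta>1 \<Theta>2 G S S_inex \<A> P_inex X :: "real mat"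
    and lam_up lam_lo :: real
  assumes "1 \<le> m" and "m \<le> n"
    and "Q \<in> carrier_mat n n" and "spsd_mat Q"
    and "A \<in> carrier_mat m n" and "vec_space.rank m A = min m n"
    and "\<Theta>1 \<in> carrier_mat n n" and "diagonal_mat \<Theta>1" and "spd_mat \<Theta>1"
    and "\<Theta>2 \<in> carrier_mat m m" and "diagonal_mat \<Theta>2" and "spsd_mat \<Theta>2"
    and "G = diag_part (Q + \<Theta>1)"
    and "S = A * mat_inv G * transpose_mat A + \<Theta>2"
    and "S_inex \<in> carrier_mat m m" and "spd_mat S_inex"
    and "\<A> = four_block_mat (Q + \<Theta>1) (transpose_mat A) A (- \<Theta>2)"
    and "P_inex =
           four_block_mat (1\<^sub>m n) (0\<^sub>m n m) (A * mat_inv G) (1\<^sub>m m)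
         * four_block_mat G (0\<^sub>m n m) (0\<^sub>m m n) (- S_inex)
         * four_block_mat (1\<^sub>m n) (mat_inv G * transpose_mat A) (0\<^sub>m m n) (1\<^sub>m m)"
    and "X = diag_inv_sqrt G * (Q + \<Theta>1) * diag_inv_sqrt G"
    and "spd_mat (2 \<cdot>\<^sub>m 1\<^sub>m n - X)"
    and "lam_up =
           (if \<Theta>2 \<noteq> 0\<^sub>m m m
            then lambda_max (mat_inv S_inex * S) * max (2 - lambda_min X) 1
            else lambda_max (mat_inv S_inex * S) * (2 - lambda_min X))"
    and "lam_lo =
           (if \<Theta>2 \<noteq> 0\<^sub>m m m
            then lambda_min (mat_inv S_inex * S) * min (2 - lambda_max X) 1
            else lambda_min (mat_inv S_inex * S) * (2 - lambda_max X))"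
  shows "num_nonreal_eigenvalues (mat_inv P_inex * \<A>) \<le> 2 * m
    \<and> (\<forall>(lam :: complex) x y.
        x \<in> carrier_vec n \<longrightarrow> y \<in> carrier_vec m \<longrightarrow>
        gen_eigenpair (cmat \<A>) (cmat P_inex) lam (x @\<^sub>v y) \<longrightarrow>
          (Im lam \<noteq> 0 \<longrightarrow>
             (lambda_min X + lam_lo) / 2 \<le> Re lam \<and> Re lam \<le> (lambda_max X + lam_up) / 2)
        \<and> (Im lam = 0 \<longrightarrow>
             (y \<noteq> 0\<^sub>v m \<longrightarrow>
                min (lambda_min X) lam_lo \<le> Re lam \<and> Re lam \<le> max (lambda_max X) lam_up)
           \<and> (y = 0\<^sub>v m \<longrightarrow> lambda_min X \<le> Re lam \<and> Re lam \<le> lambda_max X))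
        \<and> \<bar>Im lam\<bar> \<le>
             sqrt (lambda_max (mat_inv S_inex * A * mat_inv G * transpose_mat A))
             * mat_norm2 (1\<^sub>m n - X))"
proof -

  \<comment> \<open>The matrices \<open>H\<close>, \<open>G\<close>, \<open>C\<close> and
    \<open>B0\<close>\<close>
  have n0: "0 < n" and m0: "0 < m" using assms(1,2) by auto
  define H where "H = Q + \<Theta>1"
  have Hc: "H \<in> carrier_mat n n" using assms(3,7) by (simp add: H_def)
  have Hspd: "spd_mat H" unfolding H_def using assms(3,4,7,9) by (rule_tac spsd_add_spd) auto
  then have Hsym: "sym_mat H" by (simp add: spd_mat_def)
  have A: "A \<in> carrier_mat m n" and Th: "\<Theta>2 \<in> carrier_mat m m" "spsd_mat \<Theta>2"
    and Si: "S_inex \<in> carrier_mat m m" "spd_mat S_inex"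
    using assms by auto
  have Thsym: "sym_mat \<Theta>2" and Sisym: "sym_mat S_inex"
    using Th Si by (auto simp: spsd_mat_def spd_mat_def)
  have Gdef: "G = mat_diag n (\<lambda>i. H $$ (i, i))"
    using assms(13) Hc unfolding H_def by (metis carrier_matD(1) diag_part_def)
  define g where "g i = H $$ (i, i)" for i
  have g: "0 < g i" if "i < n" for i using spd_mat_diag_pos[OF Hspd Hc that] by (simp add: g_def)
  have Gg: "G = mat_diag n g" unfolding Gdef g_def ..
  have G: "G \<in> carrier_mat n n" by (simp add: Gg)
  have Gsym: "sym_mat G" using G by (auto simp: sym_mat_def Gg mat_diag_def intro!: eq_matI)
  have diag_G: "mat_diag n (\<lambda>i. 1 / g i) * G = 1\<^sub>m n"
  proof -
    have "mat_diag n (\<lambda>i. 1 / g i * g i) = mat_diag n (\<lambda>i. 1)"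
      using g[THEN less_imp_neq] by (intro eq_matI) (auto simp: mat_diag_def)
    then show ?thesis by (simp add: Gg)
  qed
  have detG: "det G \<noteq> 0"
  proof
    assume "det G = 0"
    then have "det (mat_diag n (\<lambda>i. 1 / g i) * G) = 0" using G by (simp add: det_mult[of _ n])
    then show False by (simp add: diag_G)
  qed
  note Ginv = mat_inv_carrier_inverts[OF G detG]
  let ?Gi = "mat_inv G" and ?Si = "mat_inv S_inex"
  note Siinv = mat_inv_carrier_inverts[OF Si(1) spd_mat_det_nonzero[OF Si(2,1)]]
  \<comment> \<open>\<open>C\<close> is the map in the substitution \<open>w = x + C y\<close>; as
    \<open>A = C\<^sup>T * G\<close>, it takes the place of \<open>A\<close> in the form
    computations.\<close>
  define C where "C = ?Gi * A\<^sup>T"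
  have C: "C \<in> carrier_mat n m" using Ginv A by (simp add: C_def)
  have GC: "G * C = A\<^sup>T"
  proof -
    have "G * C = (G * ?Gi) * A\<^sup>T" unfolding C_def using G Ginv(1) A by simp
    then show ?thesis using Ginv A by simp
  qed
  have CG: "C\<^sup>T * G = A"
    using transpose_mult[OF G C] GC Gsym by (simp add: sym_mat_def)
  have AGi: "A * ?Gi = C\<^sup>T"
  proof -
    have "A * ?Gi = C\<^sup>T * (G * ?Gi)" unfolding CG[symmetric] using C G Ginv(1) by simp
    then show ?thesis using C Ginv by simp
  qed
  \<comment> \<open>This is \<open>A G\<^sup>-\<^sup>1 A\<^sup>T\<close>, the part of
    \<open>S\<close> without \<open>\<Theta>2\<close>; its form at \<open>y\<close> is the form of
    \<open>G\<close> at \<open>C y\<close>.\<close>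
  define B0 where "B0 = C\<^sup>T * A\<^sup>T"
  have B0: "B0 \<in> carrier_mat m m" using C A by (simp add: B0_def)
  have AC: "A * C = B0"
  proof -
    have "A * C = (A * ?Gi) * A\<^sup>T" unfolding C_def using A Ginv(1) by simp
    then show ?thesis by (simp add: AGi B0_def)
  qed
  have Sdef: "S = B0 + \<Theta>2" using assms(14) by (simp add: AGi B0_def)

  \<comment> \<open>Block forms of the preconditioner and the system matrix\<close>
  have Pblock: "P_inex = four_block_mat G A\<^sup>T A (B0 - S_inex)"
  proof -
    let ?L = "four_block_mat (1\<^sub>m n) (0\<^sub>m n m) C\<^sup>T (1\<^sub>m m)"
    have "?L * four_block_mat G (0\<^sub>m n m) (0\<^sub>m m n) (- S_inex)
        = four_block_mat G (0\<^sub>m n m) A (- S_inex)"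
      using C G Si CG by (subst mult_four_block_mat[of _ n n _ m _ m _ _ n _ m]) auto
    moreover have "four_block_mat G (0\<^sub>m n m) A (- S_inex) * four_block_mat (1\<^sub>m n) C (0\<^sub>m m n) (1\<^sub>m m)
        = four_block_mat G A\<^sup>T A (A * C + - S_inex)"
      using C G Si GC A by (subst mult_four_block_mat[of _ n n _ m _ m _ _ n _ m]) auto
    moreover have "B0 + - S_inex = B0 - S_inex" using B0 Si by (intro eq_matI) auto
    ultimately show ?thesis using assms(18) by (simp add: AGi AC flip: C_def)
  qed
  have Pc: "P_inex \<in> carrier_mat (n + m) (n + m)"
    unfolding Pblock using G Si B0 by (intro four_block_carrier_mat) auto
  have Ablock: "\<A> = four_block_mat H A\<^sup>T A (- \<Theta>2)" using assms(17) by (simp add: H_def)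
  have Ac: "\<A> \<in> carrier_mat (n + m) (n + m)"
    unfolding Ablock using Hc Th by (intro four_block_carrier_mat) auto

  \<comment> \<open>Symmetry, and the number of non-real eigenvalues\<close>
  have B0sym: "B0\<^sup>T = B0"
  proof -
    have "B0\<^sup>T = A * C" unfolding B0_def using C A by (simp add: transpose_mult[of _ m n _ m])
    then show ?thesis by (simp add: AC)
  qed
  have count: "num_nonreal_eigenvalues (mat_inv P_inex * \<A>) \<le> 2 * m"
  proof -
    have "det P_inex \<noteq> 0"
    proof -
      let ?L = "four_block_mat (1\<^sub>m n) (0\<^sub>m n m) (A * ?Gi) (1\<^sub>m m)"
        and ?D = "four_block_mat G (0\<^sub>m n m) (0\<^sub>m m n) (- S_inex)"
        and ?U = "four_block_mat (1\<^sub>m n) (?Gi * A\<^sup>T) (0\<^sub>m m n) (1\<^sub>m m)"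
      have c: "?L \<in> carrier_mat (n + m) (n + m)" "?D \<in> carrier_mat (n + m) (n + m)"
        "?U \<in> carrier_mat (n + m) (n + m)"
        using G Si by (auto intro!: four_block_carrier_mat)
      have "det ?L = 1"
        using A Ginv(1) by (subst det_four_block_mat_upper_right_zero[of _ n _ m]) auto
      moreover have "det ?U = 1"
        using A Ginv(1) by (subst det_four_block_mat_lower_left_zero[of _ n _ m]) auto
      moreover have "det ?D = det G * det (- S_inex)"
        using G Si by (subst det_four_block_mat_upper_right_zero[of _ n _ m]) auto
      moreover have "det P_inex = det ?L * det ?D * det ?U"
        unfolding assms(18) 
        using det_mult[OF mult_carrier_mat[OF c(1,2)] c(3)] det_mult[OF c(1,2)] by simp
      ultimately show ?thesis
        using detG det_uminus_nonzero[OF Si(1) spd_mat_det_nonzero[OF Si(2,1)]] by simp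
    qed
    note Pinv = mat_inv_carrier_inverts[OF Pc this]
    \<comment> \<open>The symmetry required of \<open>P_inex\<close> times the preconditioned matrix
      is then symmetry of \<open>\<A>\<close>.\<close>
    have PA: "P_inex * (mat_inv P_inex * \<A>) = \<A>"
    proof -
      have "P_inex * (mat_inv P_inex * \<A>) = (P_inex * mat_inv P_inex) * \<A>"
        using Pc Pinv(1) Ac by simp
      then show ?thesis using Pinv(2) Ac by simp
    qed
    show ?thesis
    proof (rule num_nonreal_eigenvalues_le[OF Pc])
      show "mat_inv P_inex * \<A> \<in> carrier_mat (n + m) (n + m)" using Pinv(1) Ac by simp
      have "(B0 - S_inex)\<^sup>T = B0 - S_inex"
        using B0 Si(1) B0sym Sisym transpose_minus[of B0 m m S_inex] by (simp add: sym_mat_def)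
      moreover have "B0 - S_inex \<in> carrier_mat m m" using Si(1) by (rule minus_carrier_mat)
      ultimately show "P_inex\<^sup>T = P_inex"
        unfolding Pblock using G Gsym A by (simp add: transpose_four_block_mat sym_mat_def)
      have "(- \<Theta>2)\<^sup>T = - \<Theta>2" using Thsym by (simp add: transpose_uminus sym_mat_def)
      then have "\<A>\<^sup>T = \<A>"
        unfolding Ablock using Hc Hsym A Th by (simp add: transpose_four_block_mat sym_mat_def)
      then show "(P_inex * (mat_inv P_inex * \<A>))\<^sup>T = P_inex * (mat_inv P_inex * \<A>)"
        unfolding PA .
      fix v :: "complex vec"
      assume v: "v \<in> carrier_vec (n + m)" "v \<noteq> 0\<^sub>v (n + m)"
        and v0: "\<And>i. n \<le> i \<Longrightarrow> i < n + m \<Longrightarrow> v $ i = 0"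
      \<comment> \<open>For \<open>v\<close> supported on the first \<open>n\<close> coordinates
        only the diagonal block \<open>G\<close> enters the form, which becomes the sum of
        \<open>g i\<close> times squared moduli. This is the definite subspace of codimension
        \<open>m\<close>.\<close>
      have Pv: "(cmat P_inex *\<^sub>v v) $ i = g i * v $ i" if i: "i < n" for i
      proof -
        have "(cmat P_inex *\<^sub>v v) $ i = (\<Sum>j\<in>{..<n + m}. P_inex $$ (i, j) * v $ j)"
          using i v(1) Pc by (simp add: scalar_prod_def atLeast0LessThan)
        also have "\<dots> = (\<Sum>j\<in>{i}. P_inex $$ (i, j) * v $ j)"
        proof (intro sum.mono_neutral_right ballI)
          fix j assume "j \<in> {..<n + m} - {i}"
          then show "P_inex $$ (i, j) * v $ j = 0"
            using i v0[of j] by (cases "j < n") (auto simp: Pblock Gg mat_diag_def)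
        qed (use i in auto)
        also have "\<dots> = g i * v $ i" using i by (simp add: Pblock Gg mat_diag_def)
        finally show ?thesis .
      qed
      have "map_vec cnj v \<bullet> (cmat P_inex *\<^sub>v v) = (\<Sum>i<n + m. cnj (v $ i) * (cmat P_inex *\<^sub>v v) $ i)"
        using v(1) Pc by (simp add: scalar_prod_def[of "map_vec cnj v"] atLeast0LessThan del: index_mult_mat_vec)
      also have "\<dots> = (\<Sum>i<n. cnj (v $ i) * (cmat P_inex *\<^sub>v v) $ i)"
        using v0 by (intro sum.mono_neutral_right) (auto simp: not_less)
      also have "\<dots> = complex_of_real (\<Sum>i<n. g i * (cmod (v $ i))^2)"
        unfolding of_real_sum
        by (intro sum.cong refl) (simp add: Pv complex_norm_square mult_ac del: of_real_power index_mult_mat_vec)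
      finally have form: "map_vec cnj v \<bullet> (cmat P_inex *\<^sub>v v)
        = complex_of_real (\<Sum>i<n. g i * (cmod (v $ i))^2)" .
      obtain i where i: "i < n" "v $ i \<noteq> 0"
        using v v0 by (metis carrier_vecD eq_vecI index_zero_vec not_le)
      have "0 < (\<Sum>i<n. g i * (cmod (v $ i))^2)"
        using i g by (intro sum_pos2[of _ i]) (auto intro!: mult_nonneg_nonneg simp: less_imp_le)
      then show "map_vec cnj v \<bullet> (cmat P_inex *\<^sub>v v) \<noteq> 0" unfolding form of_real_eq_0_iff by linarith
    qed
  qed

  \<comment> \<open>Scaling by the square root of \<open>G\<close>\<close>
  define R where "R = mat_diag n (\<lambda>i. sqrt (g i))"
  define D where "D = diag_inv_sqrt G"
  have Dg: "D = mat_diag n (\<lambda>i. g i powr (- 1 / 2))"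
    unfolding D_def diag_inv_sqrt_def Gg by (intro eq_matI) (auto simp: mat_diag_def)
  have R: "R \<in> carrier_mat n n" "R\<^sup>T = R" and D: "D \<in> carrier_mat n n" "D\<^sup>T = D"
    by (auto simp: R_def Dg mat_diag_def intro!: eq_matI)
  have DR: "D * R = 1\<^sub>m n"
  proof -
    have "mat_diag n (\<lambda>i. g i powr (- 1 / 2) * sqrt (g i)) = mat_diag n (\<lambda>i. 1)"
    proof (intro eq_matI)
      fix i j assume "i < dim_row (mat_diag n (\<lambda>i. 1 :: real))" "j < dim_col (mat_diag n (\<lambda>i. 1 :: real))"
      then show "mat_diag n (\<lambda>i. g i powr (- 1 / 2) * sqrt (g i)) $$ (i, j) = mat_diag n (\<lambda>i. 1) $$ (i, j)"
        using g[of i] by (auto simp: mat_diag_def powr_half_sqrt[symmetric] simp flip: powr_add)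
    qed (auto simp: mat_diag_def)
    then show ?thesis by (simp add: R_def Dg)
  qed
  have RR: "R * R = G"
    unfolding R_def Gg mat_diag_diag using g
    by (intro eq_matI) (auto simp: mat_diag_def less_imp_le)
  have Xdef: "X = D * H * D" using assms(19) by (simp add: D_def H_def)
  have X: "X \<in> carrier_mat n n" using D Hc by (simp add: Xdef)
  have Xsym: "sym_mat X"
  proof -
    have "X\<^sup>T = D * (H * D)"
      unfolding Xdef using D Hc Hsym by (simp add: transpose_mult[of _ n n _ n] sym_mat_def)
    then show ?thesis using X D Hc by (simp add: sym_mat_def Xdef)
  qed
  have Rx: "R *\<^sub>v x \<in> carrier_vec n" if "x \<in> carrier_vec n" for x using R that by simp
  have DRx: "D *\<^sub>v (R *\<^sub>v x) = x" if "x \<in> carrier_vec n" for x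
  proof -
    have "D *\<^sub>v (R *\<^sub>v x) = (D * R) *\<^sub>v x"
      using D R that by (intro assoc_mult_mat_vec[symmetric]) auto
    then show ?thesis using DR that by simp
  qed
  \<comment> \<open>In the variable \<open>R x\<close> the forms of \<open>G\<close> and
    \<open>H\<close> become those of the identity and of \<open>X\<close>, so the extreme
    eigenvalues of \<open>X\<close> compare \<open>H\<close> with \<open>G\<close>.\<close>
  have Gform: "x \<bullet> (G *\<^sub>v z) = (R *\<^sub>v x) \<bullet> (R *\<^sub>v z)" if "x \<in> carrier_vec n" "z \<in> carrier_vec n" for x z
    using scalar_prod_transpose[of R n n x "R *\<^sub>v z"] R that by (simp flip: RR)
  have Hform: "x \<bullet> (H *\<^sub>v z) = (R *\<^sub>v x) \<bullet> (X *\<^sub>v (R *\<^sub>v z))"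
    if x: "x \<in> carrier_vec n" and z: "z \<in> carrier_vec n" for x z
  proof -
    have "X *\<^sub>v (R *\<^sub>v z) = D *\<^sub>v (H *\<^sub>v (D *\<^sub>v (R *\<^sub>v z)))"
      unfolding Xdef using D Hc R z by (simp add: assoc_mult_mat_vec[of _ n n _ n])
    then have "(R *\<^sub>v x) \<bullet> (X *\<^sub>v (R *\<^sub>v z)) = (R *\<^sub>v x) \<bullet> (D *\<^sub>v (H *\<^sub>v z))" using z by (simp add: DRx)
    also have "\<dots> = (D *\<^sub>v (R *\<^sub>v x)) \<bullet> (H *\<^sub>v z)"
      using scalar_prod_transpose[of D n n "R *\<^sub>v x" "H *\<^sub>v z"] D R Hc x z by simp
    finally show ?thesis using x by (simp add: DRx)
  qed
  have X1: "1\<^sub>m n * X = X" using X by simp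
  note RX = rayleigh_bounds[OF n0 spd_mat_one one_carrier_mat X, unfolded X1, OF Xsym]
  have RXu: "u \<bullet> (X *\<^sub>v u) \<le> lambda_max X * (u \<bullet> u)"
    and RXl: "lambda_min X * (u \<bullet> u) \<le> u \<bullet> (X *\<^sub>v u)" if "u \<in> carrier_vec n" for u
    using RX(2,3)[OF that] that by simp_all
  \<comment> \<open>The positive definite \<open>2 I - X\<close> is tested at an eigenvector for
    \<open>lambda_max X\<close>. The resulting sign of \<open>2 - lambda_max X\<close> is used when
    inequalities are multiplied by this factor.\<close>
  have lM2: "lambda_max X < 2"
  proof -
    obtain v where v: "v \<in> carrier_vec n" "v \<noteq> 0\<^sub>v n" "X *\<^sub>v v = lambda_max X \<cdot>\<^sub>v v"
      using RX(1) X by (auto simp: spectrum_def eigenvalue_def eigenvector_def)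
    have "0 < v \<bullet> ((2 \<cdot>\<^sub>m 1\<^sub>m n - X) *\<^sub>v v)"
      using assms(20) v X by (auto simp: spd_mat_def)
    also have "(2 \<cdot>\<^sub>m 1\<^sub>m n - X) *\<^sub>v v = 2 \<cdot>\<^sub>v v - lambda_max X \<cdot>\<^sub>v v"
      using v X by (simp add: minus_mult_distrib_mat_vec[of _ n n] smult_mult_mat_vec[of _ n n])
    also have "v \<bullet> (2 \<cdot>\<^sub>v v - lambda_max X \<cdot>\<^sub>v v) = (2 - lambda_max X) * (v \<bullet> v)"
      using v by (simp add: scalar_prod_minus_distrib[of _ n] algebra_simps)
    finally show ?thesis using scalar_prod_self_pos[OF v(1,2)] by (simp add: zero_less_mult_iff)
  qed

  \<comment> \<open>Rayleigh bounds weighted by \<open>S_inex\<close>\<close>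
  have Sc: "S \<in> carrier_mat m m" using B0 Th Sdef by simp
  \<comment> \<open>The weight \<open>S_inex\<close> symmetrises \<open>mat_inv S_inex * S\<close>
    to \<open>S\<close>; in the same way it takes \<open>T0\<close> to \<open>B0\<close>
    below.\<close>
  have SiS: "S_inex * (?Si * S) = S"
  proof -
    have "S_inex * (?Si * S) = (S_inex * ?Si) * S"
      using Si Siinv(1) Sc by simp
    then show ?thesis using Siinv(2) Sc by simp
  qed
  have Ssym: "sym_mat S"
    using B0 B0sym Th Thsym transpose_add[of B0 m m \<Theta>2] by (simp add: Sdef sym_mat_def)
  note RS = rayleigh_bounds[OF m0 Si(2,1), of "?Si * S", unfolded SiS, OF _ Ssym]
  define T0 where "T0 = ?Si * A * ?Gi * A\<^sup>T"
  have T0: "T0 = ?Si * B0"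
    unfolding T0_def using Siinv(1) A Ginv(1)
    by (simp add: assoc_mult_mat[of _ m m _ n] assoc_mult_mat[of _ m n _ n] AC flip: C_def)
  have SiT0: "S_inex * T0 = B0"
  proof -
    have "S_inex * T0 = (S_inex * ?Si) * B0" unfolding T0 using Si Siinv(1) B0 by simp
    then show ?thesis using Siinv(2) B0 by simp
  qed
  have T0c: "T0 \<in> carrier_mat m m" using Siinv(1) B0 by (simp add: T0)
  have "sym_mat B0" using B0 B0sym by (simp add: sym_mat_def)
  note RB = rayleigh_bounds[OF m0 Si(2,1) T0c, unfolded SiT0, OF this]
  have B0form: "y \<bullet> (B0 *\<^sub>v y) = (R *\<^sub>v (C *\<^sub>v y)) \<bullet> (R *\<^sub>v (C *\<^sub>v y))" if y: "y \<in> carrier_vec m" for y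
  proof -
    have "B0 *\<^sub>v y = C\<^sup>T *\<^sub>v (G *\<^sub>v (C *\<^sub>v y))"
      unfolding B0_def GC[symmetric] using C G y by (simp add: assoc_mult_mat_vec[of _ m n _ m] assoc_mult_mat_vec[of _ n n _ m])
    then have "y \<bullet> (B0 *\<^sub>v y) = (C *\<^sub>v y) \<bullet> (G *\<^sub>v (C *\<^sub>v y))"
      using scalar_prod_transpose[of "C\<^sup>T" m n y "G *\<^sub>v (C *\<^sub>v y)"] C G y by simp
    then show ?thesis using C y by (simp add: Gform)
  qed
  have Siform: "0 \<le> y \<bullet> (S_inex *\<^sub>v y)" if "y \<in> carrier_vec m" for y
    using spd_mat_imp_spsd_mat[OF Si(2)] Si(1) that by (rule spsd_quadratic_nonneg)
  have lT: "0 \<le> lambda_max T0"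
  proof -
    have e: "unit_vec m 0 \<in> carrier_vec m" "unit_vec m 0 \<noteq> (0\<^sub>v m :: real vec)"
      using m0 by (auto simp: unit_vec_nonzero)
    have "0 \<le> lambda_max T0 * (unit_vec m 0 \<bullet> (S_inex *\<^sub>v unit_vec m 0))"
      using RB(2)[OF e(1)] unfolding B0form[OF e(1)]
      by (rule order_trans[OF scalar_prod_self_nonneg])
    moreover have "0 < unit_vec m 0 \<bullet> (S_inex *\<^sub>v unit_vec m 0)"
      using Si e by (auto simp: spd_mat_def)
    ultimately show ?thesis by (simp add: zero_le_mult_iff)
  qed
  \<comment> \<open>The form of the second diagonal block after the substitution. With
    \<open>s = R C y\<close> it is \<open>2 (s \<bullet> s) - s \<bullet> (X s)\<close> plus the
    \<open>\<Theta>2\<close> term, to be compared with the form of \<open>S\<close>, which is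
    \<open>s \<bullet> s\<close> plus the same term.\<close>
  define bform where "bform y = 2 * ((C *\<^sub>v y) \<bullet> (G *\<^sub>v (C *\<^sub>v y))) - (C *\<^sub>v y) \<bullet> (H *\<^sub>v (C *\<^sub>v y))
    + y \<bullet> (\<Theta>2 *\<^sub>v y)" for y
  have b_bounds: "lam_lo * (y \<bullet> (S_inex *\<^sub>v y)) \<le> bform y \<and> bform y \<le> lam_up * (y \<bullet> (S_inex *\<^sub>v y))"
    if y: "y \<in> carrier_vec m" for y
  proof -
    let ?s = "R *\<^sub>v (C *\<^sub>v y)" and ?lm = "lambda_min X" and ?lM = "lambda_max X"
    have cy: "C *\<^sub>v y \<in> carrier_vec n" using C y by simp
    let ?t = "y \<bullet> (\<Theta>2 *\<^sub>v y)" and ?q = "y \<bullet> (S_inex *\<^sub>v y)" and ?b = "?s \<bullet> ?s"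
    let ?x = "?s \<bullet> (X *\<^sub>v ?s)" and ?Smax = "lambda_max (?Si * S)" and ?Smin = "lambda_min (?Si * S)"
    have bf: "bform y = 2 * ?b - ?x + ?t" unfolding bform_def using cy by (simp add: Gform Hform)
    have x: "?lm * ?b \<le> ?x" "?x \<le> ?lM * ?b" using RXl[OF Rx[OF cy]] RXu[OF Rx[OF cy]] by auto
    have b: "0 \<le> ?b" by (rule scalar_prod_self_nonneg)
    have t: "0 \<le> ?t" using Th(2,1) y by (rule spsd_quadratic_nonneg)
    have "y \<bullet> (S *\<^sub>v y) = ?b + ?t"
      unfolding Sdef B0form[OF y, symmetric] using B0 Th y
      by (simp add: add_mult_distrib_mat_vec[of _ m m] scalar_prod_add_distrib[of _ m])
    then have S: "?Smin * ?q \<le> ?b + ?t" "?b + ?t \<le> ?Smax * ?q"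
      using RS(2,3)[OF _ y] Siinv(1) Sc by simp_all
    \<comment> \<open>The part in \<open>s\<close> is comparable to \<open>s \<bullet> s\<close>
      with factors \<open>2 - lambda_max X\<close> and \<open>2 - lambda_min X\<close>, whereas the
      \<open>\<Theta>2\<close> term enters with factor 1. A common factor for both parts is
      therefore the minimum or maximum with 1, unless \<open>\<Theta>2\<close> is zero.\<close>
    show ?thesis
    proof (cases "\<Theta>2 = 0\<^sub>m m m")
      case True
      then have "\<Theta>2 *\<^sub>v y = 0\<^sub>v m" using y by (intro eq_vecI) auto
      then have t0: "?t = 0" using y by simp
      have "?lm \<le> ?lM"
        unfolding lambda_min_def using RX(1) card_finite_spectrum(1)[OF X] by simp
      then have "0 \<le> 2 - ?lm" "0 \<le> 2 - ?lM" using lM2 by auto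
      from mult_left_mono[OF S(2) this(1)] mult_left_mono[OF S(1) this(2)]
      show ?thesis using True x unfolding assms(21,22) bf t0 by (simp add: algebra_simps)
    next
      case False
      let ?M = "max (2 - ?lm) 1" and ?m = "min (2 - ?lM) 1"
      have M: "0 \<le> ?M" "2 - ?lm \<le> ?M" "1 \<le> ?M" and m: "0 \<le> ?m" "?m \<le> 2 - ?lM" "?m \<le> 1"
        using lM2 by auto
      have "bform y \<le> (2 - ?lm) * ?b + 1 * ?t" unfolding bf using x by (simp add: algebra_simps)
      also have "\<dots> \<le> ?M * ?b + ?M * ?t" using M b t by (intro add_mono mult_right_mono)
      also have "\<dots> \<le> ?M * (?Smax * ?q)" using mult_left_mono[OF S(2) M(1)] by (simp add: distrib_left)
      finally have up: "bform y \<le> lam_up * ?q" using False assms(21) by (simp add: mult_ac)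
      have "?m * (?Smin * ?q) \<le> ?m * ?b + ?m * ?t" using mult_left_mono[OF S(1) m(1)] by (simp add: distrib_left)
      also have "\<dots> \<le> (2 - ?lM) * ?b + 1 * ?t" using m b t by (intro add_mono mult_right_mono)
      also have "\<dots> \<le> bform y" unfolding bf using x by (simp add: algebra_simps)
      finally have lo: "lam_lo * ?q \<le> bform y" using False assms(22) by (simp add: mult_ac)
      from lo up show ?thesis by simp
    qed
  qed

  \<comment> \<open>The off-diagonal coupling\<close>
  define E where "E = 1\<^sub>m n - X"
  have E: "E \<in> carrier_mat n n" using X unfolding E_def by (rule minus_carrier_mat)
  have Esym: "sym_mat E"
    using E X Xsym transpose_minus[of "1\<^sub>m n" n n X] by (simp add: E_def sym_mat_def)
  \<comment> \<open>\<open>w\<close> and \<open>c\<close> are coupled through \<open>G - H\<close>,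
    which scales to \<open>E\<close>. Symmetry moves \<open>E\<close> to the first argument, so that
    its norm acts on \<open>R w\<close> while \<open>R c\<close> is left for the bound by
    \<open>lambda_max T0\<close>.\<close>
  have Eform: "x \<bullet> (G *\<^sub>v z) - x \<bullet> (H *\<^sub>v z) = (E *\<^sub>v (R *\<^sub>v x)) \<bullet> (R *\<^sub>v z)"
    if x: "x \<in> carrier_vec n" and z: "z \<in> carrier_vec n" for x z
  proof -
    have "E *\<^sub>v (R *\<^sub>v z) = R *\<^sub>v z - X *\<^sub>v (R *\<^sub>v z)"
      unfolding E_def using X Rx[OF z] by (simp add: minus_mult_distrib_mat_vec[of _ n n])
    then have "x \<bullet> (G *\<^sub>v z) - x \<bullet> (H *\<^sub>v z) = (R *\<^sub>v x) \<bullet> (E *\<^sub>v (R *\<^sub>v z))"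
      using x z X R by (simp add: Gform Hform scalar_prod_minus_distrib[of _ n])
    then show ?thesis
      using scalar_prod_transpose[of E n n "R *\<^sub>v x" "R *\<^sub>v z"] E Esym R x z by (simp add: sym_mat_def)
  qed
  note EN = mat_norm2_bound[OF E n0]

  \<comment> \<open>Bounds for a single eigenpair\<close>
  have eig: "(Im lam \<noteq> 0 \<longrightarrow>
             (lambda_min X + lam_lo) / 2 \<le> Re lam \<and> Re lam \<le> (lambda_max X + lam_up) / 2)
        \<and> (Im lam = 0 \<longrightarrow>
             (y \<noteq> 0\<^sub>v m \<longrightarrow>
                min (lambda_min X) lam_lo \<le> Re lam \<and> Re lam \<le> max (lambda_max X) lam_up)
           \<and> (y = 0\<^sub>v m \<longrightarrow> lambda_min X \<le> Re lam \<and> Re lam \<le> lambda_max X))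
        \<and> \<bar>Im lam\<bar> \<le> sqrt (lambda_max T0) * mat_norm2 E"
    if x: "x \<in> carrier_vec n" and y: "y \<in> carrier_vec m"
      and pair: "gen_eigenpair (cmat \<A>) (cmat P_inex) lam (x @\<^sub>v y)" for lam :: complex and x y
  proof -
    let ?a = "Re lam" and ?b = "Im lam"
    define x1 x2 y1 y2 where "x1 = map_vec Re x" and "x2 = map_vec Im x"
      and "y1 = map_vec Re y" and "y2 = map_vec Im y"
    have xy: "x1 \<in> carrier_vec n" "x2 \<in> carrier_vec n" "y1 \<in> carrier_vec m" "y2 \<in> carrier_vec m"
      using x y by (auto simp: x1_def x2_def y1_def y2_def)
    define c1 c2 where "c1 = C *\<^sub>v y1" and "c2 = C *\<^sub>v y2"
    define w1 w2 where "w1 = x1 + c1" and "w2 = x2 + c2"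
    have c: "c1 \<in> carrier_vec n" "c2 \<in> carrier_vec n" using C xy by (auto simp: c1_def c2_def)
    have w: "w1 \<in> carrier_vec n" "w2 \<in> carrier_vec n" using c xy by (auto simp: w1_def w2_def)
    have xw: "x1 = w1 - c1" "x2 = w2 - c2" using xy c by (auto simp: w1_def w2_def)
    have v: "x @\<^sub>v y \<in> carrier_vec (n + m)" using x y by simp
    have nz: "x @\<^sub>v y \<noteq> 0\<^sub>v (n + m)"
      and eqv: "cmat \<A> *\<^sub>v (x @\<^sub>v y) = lam \<cdot>\<^sub>v (cmat P_inex *\<^sub>v (x @\<^sub>v y))"
      using pair Ac by (auto simp: gen_eigenpair_def)
    have "map_vec Re (x @\<^sub>v y) = x1 @\<^sub>v y1" "map_vec Im (x @\<^sub>v y) = x2 @\<^sub>v y2"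
      using x y by (auto simp: x1_def x2_def y1_def y2_def)
    note real = real_imag_parts_of_pencil[OF Ac Pc v eqv, unfolded this]
    have Amul: "\<A> *\<^sub>v (x' @\<^sub>v y') = (H *\<^sub>v x' + G *\<^sub>v (C *\<^sub>v y')) @\<^sub>v (C\<^sup>T *\<^sub>v (G *\<^sub>v x') - \<Theta>2 *\<^sub>v y')"
      if "x' \<in> carrier_vec n" "y' \<in> carrier_vec m" for x' y'
    proof -
      have 1: "A\<^sup>T *\<^sub>v y' = G *\<^sub>v (C *\<^sub>v y')"
        unfolding GC[symmetric] using G C that by (intro assoc_mult_mat_vec) auto
      have 2: "A *\<^sub>v x' = C\<^sup>T *\<^sub>v (G *\<^sub>v x')"
        unfolding CG[symmetric] using G C that by (intro assoc_mult_mat_vec) auto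
      have "\<A> *\<^sub>v (x' @\<^sub>v y') = (H *\<^sub>v x' + A\<^sup>T *\<^sub>v y') @\<^sub>v (A *\<^sub>v x' + (- \<Theta>2) *\<^sub>v y')"
        unfolding Ablock using Hc A Th that by (intro four_block_mat_mult_vec) auto
      also have "A *\<^sub>v x' + (- \<Theta>2) *\<^sub>v y' = A *\<^sub>v x' - \<Theta>2 *\<^sub>v y'"
        using A Th that by (intro eq_vecI) auto
      finally show ?thesis unfolding 1 2 .
    qed
    have Pmul: "P_inex *\<^sub>v (x' @\<^sub>v y') = (G *\<^sub>v (x' + C *\<^sub>v y')) @\<^sub>v (C\<^sup>T *\<^sub>v (G *\<^sub>v (x' + C *\<^sub>v y')) - S_inex *\<^sub>v y')"
      if x': "x' \<in> carrier_vec n" and y': "y' \<in> carrier_vec m" for x' y'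
    proof -
      have 1: "A\<^sup>T *\<^sub>v y' = G *\<^sub>v (C *\<^sub>v y')"
        unfolding GC[symmetric] using G C that by (intro assoc_mult_mat_vec) auto
      have 2: "A *\<^sub>v x' = C\<^sup>T *\<^sub>v (G *\<^sub>v x')"
        unfolding CG[symmetric] using G C that by (intro assoc_mult_mat_vec) auto
      have 3: "B0 *\<^sub>v y' = C\<^sup>T *\<^sub>v (G *\<^sub>v (C *\<^sub>v y'))"
        unfolding B0_def 1[symmetric] using A C that by (intro assoc_mult_mat_vec) auto
      have "P_inex *\<^sub>v (x' @\<^sub>v y') = (G *\<^sub>v x' + A\<^sup>T *\<^sub>v y') @\<^sub>v (A *\<^sub>v x' + (B0 - S_inex) *\<^sub>v y')"
        unfolding Pblock using G A Si that
        by (intro four_block_mat_mult_vec) (auto intro: minus_carrier_mat)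
      also have "(B0 - S_inex) *\<^sub>v y' = B0 *\<^sub>v y' - S_inex *\<^sub>v y'"
        using B0 Si y' by (intro minus_mult_distrib_mat_vec) auto
      also have "A *\<^sub>v x' + (B0 *\<^sub>v y' - S_inex *\<^sub>v y') = (A *\<^sub>v x' + B0 *\<^sub>v y') - S_inex *\<^sub>v y'"
        using A B0 Si that by (intro eq_vecI) auto
      also have "A *\<^sub>v x' + B0 *\<^sub>v y' = C\<^sup>T *\<^sub>v (G *\<^sub>v (x' + C *\<^sub>v y'))"
        unfolding 2 3 using C G that
        by (simp add: mult_add_distrib_mat_vec[of _ n n] mult_add_distrib_mat_vec[of _ m n])
      also have "G *\<^sub>v x' + A\<^sup>T *\<^sub>v y' = G *\<^sub>v (x' + C *\<^sub>v y')"
        unfolding 1 using C G that by (simp add: mult_add_distrib_mat_vec[of _ n n])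
      finally show ?thesis .
    qed
    note Ps = Pmul[OF xy(1,3), folded c1_def, folded w1_def] Pmul[OF xy(2,4), folded c2_def, folded w2_def]
    note As = Amul[OF xy(1,3), folded c1_def] Amul[OF xy(2,4), folded c2_def]
    have split: "p = s \<and> q = t" if "p @\<^sub>v q = a \<cdot>\<^sub>v (s1 @\<^sub>v t1) + b \<cdot>\<^sub>v (s2 @\<^sub>v t2)"
        "s = a \<cdot>\<^sub>v s1 + b \<cdot>\<^sub>v s2" "t = a \<cdot>\<^sub>v t1 + b \<cdot>\<^sub>v t2"
        "p \<in> carrier_vec n" "s1 \<in> carrier_vec n" "s2 \<in> carrier_vec n"
        "q \<in> carrier_vec m" "t1 \<in> carrier_vec m" "t2 \<in> carrier_vec m"
      for p s s1 s2 q t t1 t2 and a b :: real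
    proof -
      have "a \<cdot>\<^sub>v (s1 @\<^sub>v t1) + b \<cdot>\<^sub>v (s2 @\<^sub>v t2) = s @\<^sub>v t"
        unfolding that(2,3) using that(4-) by (intro eq_vecI) auto
      with that(1) have "p @\<^sub>v q = s @\<^sub>v t" by simp
      moreover have "dim_vec p = dim_vec s" using that by simp
      ultimately show ?thesis using that append_vec_eq[of p n s q t] by auto
    qed
    \<comment> \<open>Rewriting the difference as a sum lets \<open>split\<close> serve the real and
      the imaginary equation alike.\<close>
    have minus: "u - k \<cdot>\<^sub>v u' = u + (- k) \<cdot>\<^sub>v u'" if "dim_vec u = dim_vec u'" for u u' :: "real vec" and k
      using that by (intro eq_vecI) auto
    have eqs: "H *\<^sub>v (w1 - c1) + G *\<^sub>v c1 = ?a \<cdot>\<^sub>v (G *\<^sub>v w1) - ?b \<cdot>\<^sub>v (G *\<^sub>v w2)"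
      "C\<^sup>T *\<^sub>v (G *\<^sub>v (w1 - c1)) - \<Theta>2 *\<^sub>v y1 =
        ?a \<cdot>\<^sub>v (C\<^sup>T *\<^sub>v (G *\<^sub>v w1) - S_inex *\<^sub>v y1) - ?b \<cdot>\<^sub>v (C\<^sup>T *\<^sub>v (G *\<^sub>v w2) - S_inex *\<^sub>v y2)"
      "H *\<^sub>v (w2 - c2) + G *\<^sub>v c2 = ?a \<cdot>\<^sub>v (G *\<^sub>v w2) + ?b \<cdot>\<^sub>v (G *\<^sub>v w1)"
      "C\<^sup>T *\<^sub>v (G *\<^sub>v (w2 - c2)) - \<Theta>2 *\<^sub>v y2 =
        ?a \<cdot>\<^sub>v (C\<^sup>T *\<^sub>v (G *\<^sub>v w2) - S_inex *\<^sub>v y2) + ?b \<cdot>\<^sub>v (C\<^sup>T *\<^sub>v (G *\<^sub>v w1) - S_inex *\<^sub>v y1)"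
    proof -
      have cs: "H *\<^sub>v (w1 - c1) + G *\<^sub>v c1 \<in> carrier_vec n" "H *\<^sub>v (w2 - c2) + G *\<^sub>v c2 \<in> carrier_vec n"
        "C\<^sup>T *\<^sub>v (G *\<^sub>v (w1 - c1)) - \<Theta>2 *\<^sub>v y1 \<in> carrier_vec m" "C\<^sup>T *\<^sub>v (G *\<^sub>v (w2 - c2)) - \<Theta>2 *\<^sub>v y2 \<in> carrier_vec m"
        "G *\<^sub>v w1 \<in> carrier_vec n" "G *\<^sub>v w2 \<in> carrier_vec n"
        "C\<^sup>T *\<^sub>v (G *\<^sub>v w1) - S_inex *\<^sub>v y1 \<in> carrier_vec m" "C\<^sup>T *\<^sub>v (G *\<^sub>v w2) - S_inex *\<^sub>v y2 \<in> carrier_vec m"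
        using Hc G C Th Si w c xy by auto
      have d: "dim_vec (G *\<^sub>v w1) = dim_vec (G *\<^sub>v w2)"
        "dim_vec (C\<^sup>T *\<^sub>v (G *\<^sub>v w1) - S_inex *\<^sub>v y1) = dim_vec (C\<^sup>T *\<^sub>v (G *\<^sub>v w2) - S_inex *\<^sub>v y2)"
        "dim_vec ((G *\<^sub>v w1) @\<^sub>v (C\<^sup>T *\<^sub>v (G *\<^sub>v w1) - S_inex *\<^sub>v y1)) =
         dim_vec ((G *\<^sub>v w2) @\<^sub>v (C\<^sup>T *\<^sub>v (G *\<^sub>v w2) - S_inex *\<^sub>v y2))"
        by simp_all
      have e1: "(H *\<^sub>v (w1 - c1) + G *\<^sub>v c1) @\<^sub>v (C\<^sup>T *\<^sub>v (G *\<^sub>v (w1 - c1)) - \<Theta>2 *\<^sub>v y1) =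
          ?a \<cdot>\<^sub>v ((G *\<^sub>v w1) @\<^sub>v (C\<^sup>T *\<^sub>v (G *\<^sub>v w1) - S_inex *\<^sub>v y1)) +
          (- ?b) \<cdot>\<^sub>v ((G *\<^sub>v w2) @\<^sub>v (C\<^sup>T *\<^sub>v (G *\<^sub>v w2) - S_inex *\<^sub>v y2))"
        using real(1) unfolding Ps As unfolding xw by (subst minus[symmetric]) auto
      have e2: "(H *\<^sub>v (w2 - c2) + G *\<^sub>v c2) @\<^sub>v (C\<^sup>T *\<^sub>v (G *\<^sub>v (w2 - c2)) - \<Theta>2 *\<^sub>v y2) =
          ?a \<cdot>\<^sub>v ((G *\<^sub>v w2) @\<^sub>v (C\<^sup>T *\<^sub>v (G *\<^sub>v w2) - S_inex *\<^sub>v y2)) +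
          ?b \<cdot>\<^sub>v ((G *\<^sub>v w1) @\<^sub>v (C\<^sup>T *\<^sub>v (G *\<^sub>v w1) - S_inex *\<^sub>v y1))"
        using real(2) unfolding Ps As unfolding xw by simp
      show "H *\<^sub>v (w1 - c1) + G *\<^sub>v c1 = ?a \<cdot>\<^sub>v (G *\<^sub>v w1) - ?b \<cdot>\<^sub>v (G *\<^sub>v w2)"
        "C\<^sup>T *\<^sub>v (G *\<^sub>v (w1 - c1)) - \<Theta>2 *\<^sub>v y1 =
        ?a \<cdot>\<^sub>v (C\<^sup>T *\<^sub>v (G *\<^sub>v w1) - S_inex *\<^sub>v y1) - ?b \<cdot>\<^sub>v (C\<^sup>T *\<^sub>v (G *\<^sub>v w2) - S_inex *\<^sub>v y2)"
        using split[OF e1 minus minus cs(1,5,6,3,7,8)] d by auto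
      show "H *\<^sub>v (w2 - c2) + G *\<^sub>v c2 = ?a \<cdot>\<^sub>v (G *\<^sub>v w2) + ?b \<cdot>\<^sub>v (G *\<^sub>v w1)"
        "C\<^sup>T *\<^sub>v (G *\<^sub>v (w2 - c2)) - \<Theta>2 *\<^sub>v y2 =
        ?a \<cdot>\<^sub>v (C\<^sup>T *\<^sub>v (G *\<^sub>v w2) - S_inex *\<^sub>v y2) + ?b \<cdot>\<^sub>v (C\<^sup>T *\<^sub>v (G *\<^sub>v w1) - S_inex *\<^sub>v y1)"
        using split[OF e2 refl refl cs(2,6,5,4,8,7)] by auto
    qed
    note ids = pencil_form_identities[OF G Gsym Hc Hsym C Th(1) Thsym Si(1) Sisym w xy(3,4) c1_def c2_def
        eqs(1,3,2,4)]

    \<comment> \<open>Estimates from the form identities\<close>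
    let ?p = "w1 \<bullet> (G *\<^sub>v w1) + w2 \<bullet> (G *\<^sub>v w2)"
      and ?q = "y1 \<bullet> (S_inex *\<^sub>v y1) + y2 \<bullet> (S_inex *\<^sub>v y2)"
      and ?f = "w1 \<bullet> (H *\<^sub>v w1) + w2 \<bullet> (H *\<^sub>v w2)"
    have main: "?f + (bform y1 + bform y2) = ?a * (?p + ?q)"
      using ids(1) unfolding bform_def c1_def c2_def by (simp add: algebra_simps)
    define u1 u2 s1 s2 where "u1 = R *\<^sub>v w1" and "u2 = R *\<^sub>v w2" and "s1 = R *\<^sub>v c1" and "s2 = R *\<^sub>v c2"
    have us: "u1 \<in> carrier_vec n" "u2 \<in> carrier_vec n" "s1 \<in> carrier_vec n" "s2 \<in> carrier_vec n"
      using R w c by (auto simp: u1_def u2_def s1_def s2_def)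
    have p: "?p = u1 \<bullet> u1 + u2 \<bullet> u2" using w by (simp add: Gform u1_def u2_def)
    have f: "lambda_min X * ?p \<le> ?f" "?f \<le> lambda_max X * ?p"
      using RXl[OF us(1)] RXl[OF us(2)] RXu[OF us(1)] RXu[OF us(2)] w
      unfolding p by (simp_all add: Hform u1_def u2_def algebra_simps)
    have b: "lam_lo * ?q \<le> bform y1 + bform y2" "bform y1 + bform y2 \<le> lam_up * ?q"
      using b_bounds[OF xy(3)] b_bounds[OF xy(4)] by (auto simp: distrib_left)
    have p0: "0 \<le> ?p" unfolding p by (simp add: scalar_prod_self_nonneg)
    have q0: "0 \<le> ?q" using Siform[OF xy(3)] Siform[OF xy(4)] by simp
    have Sipos: "0 < z \<bullet> (S_inex *\<^sub>v z)" if "z \<in> carrier_vec m" "z \<noteq> 0\<^sub>v m" for z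
      using Si that by (auto simp: spd_mat_def)
    have qpos: "0 < ?q" if "y \<noteq> 0\<^sub>v m"
    proof -
      have "y1 \<noteq> 0\<^sub>v m \<or> y2 \<noteq> 0\<^sub>v m"
      proof (rule ccontr)
        assume "\<not> ?thesis"
        then have 0: "y1 = 0\<^sub>v m" "y2 = 0\<^sub>v m" by auto
        have "y $ i = 0" if "i < m" for i
          using arg_cong[OF 0(1), of "\<lambda>v. v $ i"] arg_cong[OF 0(2), of "\<lambda>v. v $ i"] that y
          by (simp add: y1_def y2_def complex_eq_iff)
        then show False using \<open>y \<noteq> 0\<^sub>v m\<close> y by auto
      qed
      then show ?thesis
        using Sipos xy(3,4) Siform[OF xy(3)] Siform[OF xy(4)] by (auto intro: add_pos_nonneg add_nonneg_pos)
    qed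
    \<comment> \<open>For \<open>y = 0\<close> the substitution is trivial, so \<open>w = x\<close>,
      and \<open>x\<close> is nonzero because the eigenvector is.\<close>
    have y0: "?q = 0 \<and> 0 < ?p" if "y = 0\<^sub>v m"
    proof -
      have y12: "y1 = 0\<^sub>v m" "y2 = 0\<^sub>v m" using that by (auto simp: y1_def y2_def)
      then have "c1 = 0\<^sub>v n" "c2 = 0\<^sub>v n" using C by (auto simp: c1_def c2_def)
      then have wx: "w1 = x1" "w2 = x2" using xy by (auto simp: w1_def w2_def)
      have "x1 \<noteq> 0\<^sub>v n \<or> x2 \<noteq> 0\<^sub>v n"
      proof (rule ccontr)
        assume "\<not> ?thesis"
        then have 0: "x1 = 0\<^sub>v n" "x2 = 0\<^sub>v n" by auto
        have "x $ i = 0" if "i < n" for i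
          using arg_cong[OF 0(1), of "\<lambda>v. v $ i"] arg_cong[OF 0(2), of "\<lambda>v. v $ i"] that x
          by (simp add: x1_def x2_def complex_eq_iff)
        then have "x = 0\<^sub>v n" using x by auto
        then show False using nz \<open>y = 0\<^sub>v m\<close> by auto
      qed
      moreover have "0 < z \<bullet> (G *\<^sub>v z)" if z: "z \<in> carrier_vec n" "z \<noteq> 0\<^sub>v n" for z
      proof -
        have "D *\<^sub>v 0\<^sub>v n = 0\<^sub>v n" using D by (intro eq_vecI) auto
        then have "R *\<^sub>v z \<noteq> 0\<^sub>v n" using DRx[OF z(1)] z(2) by auto
        then show ?thesis using scalar_prod_self_pos[OF Rx[OF z(1)]] z(1) by (simp add: Gform)
      qed
      moreover have "0 \<le> z \<bullet> (G *\<^sub>v z)" if "z \<in> carrier_vec n" for z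
        using that by (simp add: Gform scalar_prod_self_nonneg)
      ultimately have "0 < ?p"
        unfolding wx using xy(1,2) by (auto intro: add_pos_nonneg add_nonneg_pos)
      moreover have "?q = 0" unfolding y12 using Si by simp
      ultimately show ?thesis by simp
    qed
    have pq: "0 < ?p + ?q" using p0 q0 qpos y0 by (cases "y = 0\<^sub>v m") auto
    have Im_bound: "\<bar>?b\<bar> \<le> sqrt (lambda_max T0) * mat_norm2 E"
    proof (cases "?b = 0")
      case True
      then show ?thesis using lT EN(1) by simp
    next
      case False
      \<comment> \<open>The coupling equals both \<open>?b * ?p\<close> and \<open>?b * ?q\<close>;
        the weights agree, and both are positive since their sum is.\<close>
      then have peq: "?p = ?q" using ids(2,3) by simp
      with pq have pp: "0 < ?p" by simp
      have h: "?b * ?p = (E *\<^sub>v u1) \<bullet> s2 - (E *\<^sub>v u2) \<bullet> s1"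
        using ids(2) Eform[OF w(1) c(2)] Eform[OF w(2) c(1)] by (simp add: u1_def u2_def s1_def s2_def)
      have "(?b * ?p)^2 \<le> ((E *\<^sub>v u1) \<bullet> (E *\<^sub>v u1) + (E *\<^sub>v u2) \<bullet> (E *\<^sub>v u2)) * (s1 \<bullet> s1 + s2 \<bullet> s2)"
        unfolding h using E us by (intro cross_scalar_prod_bound[of _ n]) auto
      \<comment> \<open>The first factor is measured by \<open>?p\<close> through the norm of
        \<open>E\<close>, the second by \<open>?q\<close> through the Rayleigh bound for
        \<open>B0\<close>. As \<open>?p = ?q\<close>, the product is a perfect square and
        \<open>?p\<close> cancels.\<close>
      also have "\<dots> \<le> ((mat_norm2 E)^2 * ?p) * (lambda_max T0 * ?q)"
      proof (rule mult_mono)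
        show "(E *\<^sub>v u1) \<bullet> (E *\<^sub>v u1) + (E *\<^sub>v u2) \<bullet> (E *\<^sub>v u2) \<le> (mat_norm2 E)^2 * ?p"
          unfolding p using EN(2)[OF us(1)] EN(2)[OF us(2)] by (simp add: distrib_left)
        show "s1 \<bullet> s1 + s2 \<bullet> s2 \<le> lambda_max T0 * ?q"
          using RB(2)[OF xy(3)] RB(2)[OF xy(4)] unfolding B0form[OF xy(3)] B0form[OF xy(4)]
          by (simp add: s1_def s2_def c1_def c2_def distrib_left)
      qed (simp_all add: p0 scalar_prod_self_nonneg)
      also have "\<dots> = (sqrt (lambda_max T0) * mat_norm2 E * ?p)^2"
        unfolding peq[symmetric] using lT by (simp add: power_mult_distrib power2_eq_square mult_ac)
      finally show ?thesis
        using pp mult_nonneg_nonneg[OF real_sqrt_ge_zero[OF lT] EN(1)] by (rule abs_le_of_scaled_square_le)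
    qed
    note wb = weighted_mean_bounds[OF f b main p0 q0 pq]
    have "?p = ?q" if "?b \<noteq> 0" using ids(2,3) that by simp
    then have "(lambda_min X + lam_lo) / 2 \<le> ?a \<and> ?a \<le> (lambda_max X + lam_up) / 2" if "?b \<noteq> 0"
      using wb(3,4) that by blast
    moreover have "min (lambda_min X) lam_lo \<le> ?a \<and> ?a \<le> max (lambda_max X) lam_up"
      using wb(1,2) by blast
    moreover have "lambda_min X \<le> ?a \<and> ?a \<le> lambda_max X" if "y = 0\<^sub>v m"
      using wb(5,6) y0[OF that] by blast
    ultimately show ?thesis using Im_bound by blast
  qed
  show ?thesis
    using count eig unfolding T0_def E_def by blast
qed

end
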